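(* Assume the setting and conventions in the context (steps $k=1,\dots,N$ of a Galerkin variational integrator with Galerkin curves $\tilde q_n$, local exact solutions $\bar q$, Galerkin Noether map $I_d$, Noether quantity $I(p,q)=p^Ta(q)$, and quadrature errors $e_q$). Suppose that: (i) the quadrature rule satisfies, for all $q_n\in\mathbb{M}^n([0,h],Q)$, $\left|\int_0^hL(q_n,\dot q_n)\,dt-h\sum_jb_jL(q_n(c_jh),\dot q_n(c_jh))\right|\le C_gK_g^n$ with $K_g<1$ and $C_g,K_g$ independent of $n$ (for $n$-refinement), or $\le C_gh^{n+1}$ with $C_g$ independent of $h$ (for $h$-refinement); (ii) $\frac{\partial L}{\partial q}$, $\frac{\partial L}{\partial\dot q}$ and $\frac{d}{dt}\frac{\partial L}{\partial\dot q}$ are Lipschitz continuous; (iii) $\|\phi_1\|_{L^\infty([0,h])}$ is bounded under $n$-refinement; (iv) $\|\tilde q_n-\bar q\|_{W^{1,1}([0,h])}$ is bounded below by the quadrature error, i.e. on every step it is at least $|e_q(\tilde q_n-\bar q,\dot{\tilde q}_n-\dot{\bar q})|$ and at least $|e_q(\bar q,\dot{\bar q})|$; (v) $\phi_1(0)=1$ and $\phi_1(h)=0$; (vi) the sequence $\{|a(q_k)|\}_{k=1}^N$ is bounded by a constant $C_a$ independent of $N$; (vii) the Noether map $I(p,q)$ is Lipschitz continuous in both its arguments. Define $\tilde p_n=\frac{\partial L}{\partial\dot q}(\tilde q_n,\dot{\tilde q}_n)$. Then there exists a constant $C_v$, independent of the number $N$ of method steps, such that for every $t\in[0,Nh]$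 $$|I(p(0),q(0))-I(\tilde p_n(t),\tilde q_n(t))|\le C_v\left(\|\tilde q_n-\bar q\|_{W^{1,1}([0,h])}+\|\tilde q_n-\bar q\|_{L^\infty([0,h])}+\|\dot{\tilde q}_n-\dot{\bar q}\|_{L^\infty([0,h])}\right),$$ where the bracket on the right is understood as its maximum over the steps $k=1,\dots,N$.
   Context: $Q=\mathbb{R}^D$, $L:TQ\to\mathbb{R}$ is a Lagrangian, $\{\phi_i\}_{i=1}^n$ is a basis of functions on $[0,h]$ spanning (with $Q$-valued coefficients) the space $\mathbb{M}^n([0,h],Q)\subset C^2([0,h],Q)$, and $f\mapsto h\sum_{j=1}^mb_jf(c_jh)$ is the quadrature rule. The Galerkin discrete Lagrangian $L_d(q_k,q_{k+1})$ is the stationary value of $h\sum_jb_jL(q_n(c_jh),\dot q_n(c_jh))$ over $q_n\in\mathbb{M}^n([0,h],Q)$ with $q_n(0)=q_k$, $q_n(h)=q_{k+1}$. A discrete trajectory $(q_k)$ satisfies the discrete Euler--Lagrange equations $D_2L_d(q_{k-1},q_k)+D_1L_d(q_k,q_{k+1})=0$. On step $k$, covering the time interval $[(k-1)h,kh]$ and parametrized by local time in $[0,h]$: the Galerkin curve $\tilde q_n=\sum_{i=1}^nq_k^i\phi_i$ (with $q_k^1=q_k$, so $\partial\tilde q_n/\partial q_k=\phi_1$) is the minimizer of the discrete action with endpoints $q_k,q_{k+1}$, and the local exact solution $\bar q$ is the solution of the Euler--Lagrange equations minimizing $\int_0^hL(q,\dot q)\,dt$ with endpoints $q_k,q_{k+1}$;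 $\bar p=\frac{\partial L}{\partial\dot q}(\bar q,\dot{\bar q})$. Concatenating over steps gives $\tilde q_n(t),\tilde p_n(t)$ for $t\in[0,Nh]$. $(q(0),p(0))$ are the initial data of the global exact solution of the Euler--Lagrange equations, which by convention coincides with $\bar q$ on the first step. $\{g_s:s\in\mathbb{R}\}$ is a one-parameter group of transformations of $Q$ leaving both $L$ and $L_d$ invariant, with infinitesimal generator $a(q)=\frac{d}{ds}\big|_{s=0}g_s(q)$; the Noether quantity is $I(p,q)=p^Ta(q)$, $p=\frac{\partial L}{\partial\dot q}$. The Galerkin Noether map is $$I_d(q(t),q_k)=-\left(h\sum_{j=1}^mb_j\left[\frac{\partial L}{\partial q}(q,\dot q)\phi_1+\frac{\partial L}{\partial\dot q}(q,\dot q)\dot\phi_1\right](c_jh)\right)^Ta(q_k),$$ so that $I_d(\tilde q_n,q_k)=p_k^Ta(q_k)$, with $p_k=-D_1L_d(q_k,q_{k+1})$, is the discrete Noether quantity. Quadrature errors: for $F_q=\frac{\partial L}{\partial q}(q,\dot q)\phi_1+\frac{\partial L}{\partial\dot q}(q,\dot q)\dot\phi_1$, set $e_q(\bar q,\dot{\bar q})=h\sum_jb_jF_{\bar q}(c_jh)-\int_0^hF_{\bar q}\,dt$ and $e_q(\tilde q_n-\bar q,\dot{\tilde q}_n-\dot{\bar q})=h\sum_jb_j(F_{\tilde q_n}-F_{\bar q})(c_jh)-\int_0^h(F_{\tilde q_n}-F_{\bar q})\,dt$. Lipschitz continuity of $\frac{d}{dt}\frac{\partial L}{\partial\dot q}$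 means $\left|\frac{d}{dt}\frac{\partial L}{\partial\dot q}(\tilde q_n,\dot{\tilde q}_n)-\frac{d}{dt}\frac{\partial L}{\partial\dot q}(\bar q,\dot{\bar q})\right|\le L_3|(\tilde q_n,\dot{\tilde q}_n)-(\bar q,\dot{\bar q})|$ pointwise. Norm: $\|f\|_{W^{1,1}([0,h])}=\int_0^h|f|\,dt+\int_0^h|\dot f|\,dt$. *)

theory Defs
  imports "HOL-Analysis.Analysis"
begin

definition C2_on :: "'a::real_normed_vector set \<Rightarrow> ('a \<Rightarrow> 'b::real_normed_vector) \<Rightarrow> bool" where
  "C2_on S f \<longleftrightarrow>
     (\<exists>(f' :: 'a \<Rightarrow> 'a \<Rightarrow>\<^sub>L 'b) (f'' :: 'a \<Rightarrow> 'a \<Rightarrow>\<^sub>L 'a \<Rightarrow>\<^sub>L 'b).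
        (\<forall>x\<in>S. (f has_derivative blinfun_apply (f' x)) (at x within S)) \<and>
        (\<forall>x\<in>S. (f' has_derivative blinfun_apply (f'' x)) (at x within S)) \<and>
        continuous_on S f'')"

(* Partial gradients of a real function of two vector arguments. For a Lagrangian L q v these are
   dL/dq and dL/d(qdot); for a discrete Lagrangian they are D_1 L_d and D_2 L_d. *)

definition grad1 :: "('a::real_inner \<Rightarrow> 'b \<Rightarrow> real) \<Rightarrow> 'a \<Rightarrow> 'b \<Rightarrow> 'a" where
  "grad1 F x y = (THE D. GDERIV (\<lambda>u. F u y) x :> D)"

definition grad2 :: "('a \<Rightarrow> 'b::real_inner \<Rightarrow> real) \<Rightarrow> 'a \<Rightarrow> 'b \<Rightarrow> 'b" where
  "grad2 F x y = (THE D. GDERIV (\<lambda>u. F x u) y :> D)"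

(* Curves on a time interval {0..T} are total functions of which only the restriction to {0..T}
   matters; at the end points velocities are one-sided. *)

definition velocity :: "real \<Rightarrow> (real \<Rightarrow> 'a::real_normed_vector) \<Rightarrow> real \<Rightarrow> 'a" where
  "velocity T q t = vector_derivative q (at t within {0..T})"

definition momentum ::
    "('a::euclidean_space \<Rightarrow> 'a \<Rightarrow> real) \<Rightarrow> real \<Rightarrow> (real \<Rightarrow> 'a) \<Rightarrow> real \<Rightarrow> 'a" where
  "momentum L T q t = grad2 L (q t) (velocity T q t)"

definition action :: "('a::euclidean_space \<Rightarrow> 'a \<Rightarrow> real) \<Rightarrow> real \<Rightarrow> (real \<Rightarrow> 'a) \<Rightarrow> real" where
  "action L T q = integral {0..T} (\<lambda>t. L (q t) (velocity T q t))"

definition euler_lagrange ::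
    "('a::euclidean_space \<Rightarrow> 'a \<Rightarrow> real) \<Rightarrow> real \<Rightarrow> (real \<Rightarrow> 'a) \<Rightarrow> bool" where
  "euler_lagrange L T q \<longleftrightarrow>
     C2_on {0..T} q \<and>
     (\<forall>t\<in>{0..T}. (momentum L T q has_vector_derivative grad1 L (q t) (velocity T q t))
                   (at t within {0..T}))"

definition local_exact_solution ::
    "('a::euclidean_space \<Rightarrow> 'a \<Rightarrow> real) \<Rightarrow> real \<Rightarrow> 'a \<Rightarrow> 'a \<Rightarrow> (real \<Rightarrow> 'a) \<Rightarrow> bool" where
  "local_exact_solution L h x y q \<longleftrightarrow>
     euler_lagrange L h q \<and> q 0 = x \<and> q h = y \<and>
     (\<forall>r. C2_on {0..h} r \<and> r 0 = x \<and> r h = y \<longrightarrow> action L h q \<le> action L h r)"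


(* L-infinity norm on {0..h}; the plain supremum is used because all functions it is applied to
   are continuous on {0..h}. *)
definition Linf_norm :: "real \<Rightarrow> (real \<Rightarrow> 'a::real_normed_vector) \<Rightarrow> real" where
  "Linf_norm h f = (SUP t\<in>{0..h}. norm (f t))"

definition W11_norm :: "real \<Rightarrow> (real \<Rightarrow> 'a::euclidean_space) \<Rightarrow> real" where
  "W11_norm h f =
     integral {0..h} (\<lambda>t. norm (f t)) + integral {0..h} (\<lambda>t. norm (velocity h f t))"


(* A Galerkin method: number n of basis functions, step size h, basis functions phi_1, ..., phi_n
   on {0..h}, and a quadrature rule with m nodes c_j h and weights b_j (j = 1, ..., m). *)
record galerkin =
  gdim :: nat
  gstep :: real
  gbasis :: "nat \<Rightarrow> real \<Rightarrow> real"
  qsize :: nat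
  qweight :: "nat \<Rightarrow> real"
  qnode :: "nat \<Rightarrow> real"

definition galerkin_method :: "galerkin \<Rightarrow> bool" where
  "galerkin_method G \<longleftrightarrow>
     gdim G \<ge> 1 \<and> gstep G > 0 \<and>
     (\<forall>i\<in>{1..gdim G}. C2_on {0..gstep G} (gbasis G i)) \<and>
     (\<forall>\<alpha> :: nat \<Rightarrow> real. (\<forall>t\<in>{0..gstep G}. (\<Sum>i=1..gdim G. \<alpha> i * gbasis G i t) = 0)
         \<longrightarrow> (\<forall>i\<in>{1..gdim G}. \<alpha> i = 0)) \<and>
     (\<forall>j\<in>{1..qsize G}. 0 \<le> qnode G j \<and> qnode G j \<le> 1)"

definition galerkin_curve :: "galerkin \<Rightarrow> (nat \<Rightarrow> 'a::euclidean_space) \<Rightarrow> real \<Rightarrow> 'a" where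
  "galerkin_curve G \<xi> t = (\<Sum>i=1..gdim G. gbasis G i t *\<^sub>R \<xi> i)"

definition galerkin_space :: "galerkin \<Rightarrow> (real \<Rightarrow> 'a::euclidean_space) set" where
  "galerkin_space G = range (galerkin_curve G)"

definition quadrature :: "galerkin \<Rightarrow> (real \<Rightarrow> 'a::real_vector) \<Rightarrow> 'a" where
  "quadrature G f = gstep G *\<^sub>R (\<Sum>j=1..qsize G. qweight G j *\<^sub>R f (qnode G j * gstep G))"

definition discrete_action ::
    "('a::euclidean_space \<Rightarrow> 'a \<Rightarrow> real) \<Rightarrow> galerkin \<Rightarrow> (real \<Rightarrow> 'a) \<Rightarrow> real" where
  "discrete_action L G q = quadrature G (\<lambda>t. L (q t) (velocity (gstep G) q t))"

definition discrete_stationary ::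
    "('a::euclidean_space \<Rightarrow> 'a \<Rightarrow> real) \<Rightarrow> galerkin \<Rightarrow> 'a \<Rightarrow> 'a \<Rightarrow> (real \<Rightarrow> 'a) \<Rightarrow> bool" where
  "discrete_stationary L G x y q \<longleftrightarrow>
     q \<in> galerkin_space G \<and> q 0 = x \<and> q (gstep G) = y \<and>
     (\<forall>\<delta>\<in>galerkin_space G. \<delta> 0 = 0 \<and> \<delta> (gstep G) = 0 \<longrightarrow>
        ((\<lambda>\<epsilon>. discrete_action L G (\<lambda>t. q t + \<epsilon> *\<^sub>R \<delta> t)) has_real_derivative 0) (at 0))"

definition discrete_minimizer ::
    "('a::euclidean_space \<Rightarrow> 'a \<Rightarrow> real) \<Rightarrow> galerkin \<Rightarrow> 'a \<Rightarrow> 'a \<Rightarrow> (real \<Rightarrow> 'a) \<Rightarrow> bool" where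
  "discrete_minimizer L G x y q \<longleftrightarrow>
     q \<in> galerkin_space G \<and> q 0 = x \<and> q (gstep G) = y \<and>
     (\<forall>r\<in>galerkin_space G. r 0 = x \<and> r (gstep G) = y \<longrightarrow>
        discrete_action L G q \<le> discrete_action L G r)"

(* "The stationary value" is a definite description: the discrete Lagrangian is meaningful on the
   set of end point pairs joined by exactly one stationary curve. *)

definition Ld_domain :: "('a::euclidean_space \<Rightarrow> 'a \<Rightarrow> real) \<Rightarrow> galerkin \<Rightarrow> ('a \<times> 'a) set" where
  "Ld_domain L G = {(x, y). \<exists>!q. discrete_stationary L G x y q}"

definition Ld :: "('a::euclidean_space \<Rightarrow> 'a \<Rightarrow> real) \<Rightarrow> galerkin \<Rightarrow> 'a \<Rightarrow> 'a \<Rightarrow> real" where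
  "Ld L G x y = discrete_action L G (THE q. discrete_stationary L G x y q)"


definition one_parameter_group :: "(real \<Rightarrow> 'a::euclidean_space \<Rightarrow> 'a) \<Rightarrow> bool" where
  "one_parameter_group g \<longleftrightarrow>
     C2_on UNIV (\<lambda>(s, x). g s x) \<and> g 0 = id \<and> (\<forall>s t. g (s + t) = g s \<circ> g t)"

definition generator :: "(real \<Rightarrow> 'a::euclidean_space \<Rightarrow> 'a) \<Rightarrow> 'a \<Rightarrow> 'a" where
  "generator g x = vector_derivative (\<lambda>s. g s x) (at 0)"

(* Transformations of Q act on the tangent bundle TQ by their tangent lifts. *)
definition invariant_lagrangian ::
    "(real \<Rightarrow> 'a::euclidean_space \<Rightarrow> 'a) \<Rightarrow> ('a \<Rightarrow> 'a \<Rightarrow> real) \<Rightarrow> bool" where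
  "invariant_lagrangian g L \<longleftrightarrow>
     (\<forall>s x v. L (g s x) (frechet_derivative (g s) (at x) v) = L x v)"

definition invariant_Ld ::
    "(real \<Rightarrow> 'a::euclidean_space \<Rightarrow> 'a) \<Rightarrow> ('a \<Rightarrow> 'a \<Rightarrow> real) \<Rightarrow> galerkin \<Rightarrow> bool" where
  "invariant_Ld g L G \<longleftrightarrow>
     (\<forall>s x y. (x, y) \<in> Ld_domain L G \<and> (g s x, g s y) \<in> Ld_domain L G \<longrightarrow>
        Ld L G (g s x) (g s y) = Ld L G x y)"

definition noether_map ::
    "(real \<Rightarrow> 'a::euclidean_space \<Rightarrow> 'a) \<Rightarrow> 'a \<Rightarrow> 'a \<Rightarrow> real" where
  "noether_map g p q = p \<bullet> generator g q"


(* The integrand F_q of the Galerkin Noether map: its quadrature is D_1 L_d when q is the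
   Galerkin curve. *)
definition noether_integrand ::
    "('a::euclidean_space \<Rightarrow> 'a \<Rightarrow> real) \<Rightarrow> galerkin \<Rightarrow> (real \<Rightarrow> 'a) \<Rightarrow> real \<Rightarrow> 'a" where
  "noether_integrand L G q t =
     gbasis G 1 t *\<^sub>R grad1 L (q t) (velocity (gstep G) q t)
     + velocity (gstep G) (gbasis G 1) t *\<^sub>R grad2 L (q t) (velocity (gstep G) q t)"

definition quadrature_error :: "galerkin \<Rightarrow> (real \<Rightarrow> 'a::euclidean_space) \<Rightarrow> 'a" where
  "quadrature_error G f = quadrature G f - integral {0..gstep G} f"


(* N steps of the integrator. Step k (k = 1, ..., N) joins q k to q (k + 1); qg k and qe k are the
   Galerkin curve and the local exact solution on that step, in local time {0..h}. The curve
   qx is the global exact solution on {0..N h}. *)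
definition galerkin_trajectory ::
    "('a::euclidean_space \<Rightarrow> 'a \<Rightarrow> real) \<Rightarrow> galerkin \<Rightarrow> nat \<Rightarrow> (nat \<Rightarrow> 'a) \<Rightarrow>
     (nat \<Rightarrow> real \<Rightarrow> 'a) \<Rightarrow> (nat \<Rightarrow> real \<Rightarrow> 'a) \<Rightarrow> (real \<Rightarrow> 'a) \<Rightarrow> bool" where
  "galerkin_trajectory L G N q qg qe qx \<longleftrightarrow>
     (\<forall>k\<in>{1..N}.
        (q k, q (k + 1)) \<in> interior (Ld_domain L G) \<and>
        (\<lambda>(x, y). Ld L G x y) differentiable (at (q k, q (k + 1))) \<and>
        (\<exists>\<xi>. qg k = galerkin_curve G \<xi> \<and> \<xi> 1 = q k) \<and>
        discrete_minimizer L G (q k) (q (k + 1)) (qg k) \<and>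
        local_exact_solution L (gstep G) (q k) (q (k + 1)) (qe k)) \<and>
     (\<forall>k\<in>{2..N}. grad2 (Ld L G) (q (k - 1)) (q k) + grad1 (Ld L G) (q k) (q (k + 1)) = 0) \<and>
     euler_lagrange L (real N * gstep G) qx \<and>
     (\<forall>t\<in>{0..gstep G}. qx t = qe 1 t)"

end

theory Submission
  imports Defs
begin

text \<open>On each step, integrating by parts against \<open>\<phi>\<^sub>1\<close> turns the initial momentum of the exact
  solution into \<open>- \<integral> F\<close>, where \<open>F\<close> is the integrand of the Galerkin Noether map, while the envelope
  theorem turns the discrete momentum \<open>- D\<^sub>1 L\<^sub>d\<close> into minus the quadrature of the same integrand
  along the Galerkin curve. The two momenta therefore differ by quadrature errors and an integral,
  all bounded by the error of the Galerkin curve. Since the discrete Noether quantity is the same on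
  all steps and the exact one is constant within each step, these differences do not accumulate:
  only the first step and the current one contribute.\<close>

text \<open>The obstacle is that only the size of \<open>gbasis G 1\<close> is bounded uniformly
  under refinement, not the size of its velocity, which multiplies \<open>grad2 L\<close> in the
  Noether integrand. The integrals along the Galerkin and the exact curve are therefore not compared
  term by term. With \<phi> for \<open>gbasis G 1\<close> and p_g, p_e for the two momenta, the
  derivative of \<phi> (p_g - p_e) is subtracted beforehand. The velocity of \<phi> disappears; what
  remains is the derivative of the momentum difference, controlled by \<open>L3\<close>, and a
  boundary term at time 0, which brings in the supremum norms. The envelope theorem is not proved by
  differentiating the stationary curve with respect to its end points. It comes from a one-sided
  inequality between two differentiable functions of the perturbation that agree at 0, so that their
  derivatives there coincide.\<close>

section \<open>Partial gradients and the total derivative\<close>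

lemma GDERIV_unique:
  assumes "GDERIV f x :> d" "GDERIV f x :> e"
  shows "d = e"
proof -
  have "(\<lambda>h. h \<bullet> d) = (\<lambda>h. h \<bullet> e)"
    using assms unfolding gderiv_def by (rule has_derivative_unique)
  then have "\<forall>h. h \<bullet> d = h \<bullet> e"
    by (simp add: fun_eq_iff)
  then show ?thesis
    by (simp add: vector_eq_ldot)
qed

text \<open>A linear functional \<open>D\<close> is represented by the vector
  \<open>adjoint D 1\<close>, and uniqueness of gradients makes the definite description pick this
  vector. It gives \<open>grad1\<close> and \<open>grad2\<close> a meaning at points of
  differentiability.\<close>

lemma has_derivative_inner_The_GDERIV:
  fixes f :: "'a::euclidean_space \<Rightarrow> real"
  assumes f: "(f has_derivative D) (at x)"
  shows "D u = u \<bullet> (THE d. GDERIV f x :> d)"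
proof -
  have "D = (\<lambda>u. u \<bullet> adjoint D 1)"
    using adjoint_works[OF has_derivative_linear[OF f], of _ 1] by auto
  then have g: "GDERIV f x :> adjoint D 1"
    using f unfolding gderiv_def by metis
  have "(THE d. GDERIV f x :> d) = adjoint D 1"
    using g by (rule the_equality) (rule GDERIV_unique[OF _ g])
  then show ?thesis
    using \<open>D = (\<lambda>u. u \<bullet> adjoint D 1)\<close> by metis
qed

text \<open>Freezing one argument composes \<open>F\<close> with an affine embedding, so each
  partial gradient represents \<open>D\<close> on one factor of the product; linearity of
  \<open>D\<close> adds the two.\<close>

lemma has_derivative_grad:
  fixes F :: "'a::euclidean_space \<Rightarrow> 'b::euclidean_space \<Rightarrow> real"
  assumes D: "((\<lambda>(x, y). F x y) has_derivative D) (at (x, y))"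
  shows "D (u, v) = u \<bullet> grad1 F x y + v \<bullet> grad2 F x y"
proof -
  have "((\<lambda>u. F u y) has_derivative (\<lambda>u. D (u, 0))) (at x)"
    using has_derivative_compose[of "\<lambda>u. (u, y)" "\<lambda>u. (u, 0)" x UNIV "\<lambda>(x, y). F x y" D] D
    by (simp add: has_derivative_Pair)
  then have "D (u, 0) = u \<bullet> grad1 F x y"
    unfolding grad1_def by (rule has_derivative_inner_The_GDERIV)
  moreover
  have "((\<lambda>v. F x v) has_derivative (\<lambda>v. D (0, v))) (at y)"
    using has_derivative_compose[of "\<lambda>v. (x, v)" "\<lambda>v. (0, v)" y UNIV "\<lambda>(x, y). F x y" D] D
    by (simp add: has_derivative_Pair)
  then have "D (0, v) = v \<bullet> grad2 F x y"
    unfolding grad2_def by (rule has_derivative_inner_The_GDERIV)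
  moreover have "D (u, v) = D (u, 0) + D (0, v)"
    using linear_add[OF has_derivative_linear[OF D], of "(u, 0)" "(0, v)"] by simp
  ultimately show ?thesis by simp
qed

lemma differentiable_has_derivative_grad:
  fixes F :: "'a::euclidean_space \<Rightarrow> 'b::euclidean_space \<Rightarrow> real"
  assumes "(\<lambda>(x, y). F x y) differentiable (at (x, y))"
  shows "((\<lambda>(x, y). F x y) has_derivative (\<lambda>(u, v). u \<bullet> grad1 F x y + v \<bullet> grad2 F x y))
           (at (x, y))"
proof -
  obtain D where D: "((\<lambda>(x, y). F x y) has_derivative D) (at (x, y))"
    using assms unfolding differentiable_def by blast
  moreover have "D = (\<lambda>(u, v). u \<bullet> grad1 F x y + v \<bullet> grad2 F x y)"
    using has_derivative_grad[OF D] by auto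
  ultimately show ?thesis by simp
qed

section \<open>Consequences of two continuous derivatives\<close>

lemma C2_on_UNIV_differentiable:
  "C2_on UNIV f \<Longrightarrow> f differentiable (at z)"
  unfolding C2_on_def differentiable_def by auto

text \<open>In an orthonormal basis the coordinates of \<open>grad2 L\<close> are the values
  \<open>f' z (0, b)\<close>, and evaluation at a fixed vector is linear in \<open>f' z\<close>; so
  differentiability of \<open>f'\<close> passes to the gradient.\<close>

lemma C2_on_grad2_differentiable:
  fixes L :: "'a::euclidean_space \<Rightarrow> 'b::euclidean_space \<Rightarrow> real"
  assumes "C2_on UNIV (\<lambda>(x, v). L x v)"
  shows "(\<lambda>(x, v). grad2 L x v) differentiable (at z)"
proof -
  obtain f' :: "'a \<times> 'b \<Rightarrow> ('a \<times> 'b) \<Rightarrow>\<^sub>L real" and f''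
    where f': "\<And>z. ((\<lambda>(x, v). L x v) has_derivative blinfun_apply (f' z)) (at z)"
      and f'': "\<And>z. (f' has_derivative blinfun_apply (f'' z)) (at z)"
    using assms unfolding C2_on_def by auto
  have "(\<lambda>(x, v). grad2 L x v) = (\<lambda>z. \<Sum>b\<in>Basis. f' z (0, b) *\<^sub>R b)"
  proof (rule ext, clarify)
    fix x v
    have "(\<Sum>b\<in>Basis. f' (x, v) (0, b) *\<^sub>R b) = (\<Sum>b\<in>Basis. (grad2 L x v \<bullet> b) *\<^sub>R b)"
      using has_derivative_grad[OF f'[of "(x, v)"]] by (simp add: inner_commute)
    then show "grad2 L x v = (\<Sum>b\<in>Basis. f' (x, v) (0, b) *\<^sub>R b)"
      by (simp add: euclidean_representation)
  qed
  moreover have "((\<lambda>z. \<Sum>b\<in>Basis. f' z (0, b) *\<^sub>R b) has_derivative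
      (\<lambda>u. \<Sum>b\<in>Basis. f'' z u (0, b) *\<^sub>R b)) (at z)"
    by (auto intro!: derivative_eq_intros f'' simp: blinfun.bilinear_simps)
  ultimately show ?thesis unfolding differentiable_def by auto
qed

text \<open>The integral of a mixed derivative along one direction is a difference of derivatives in
  the other one; differentiating it gives the symmetry.\<close>

lemma second_derivative_symmetric:
  fixes f :: "'a::real_normed_vector \<Rightarrow> 'b::banach"
  assumes f': "\<And>z. (f has_derivative blinfun_apply (f' z)) (at z)"
    and f'': "\<And>z. (f' has_derivative blinfun_apply (f'' z)) (at z)"
    and cont: "continuous_on UNIV f''"
  shows "f'' p u w = f'' p w u"
proof -
  have cont': "continuous_on S (\<lambda>x. f'' (k x))" if "continuous_on S k" for S and k :: "'c::topological_space \<Rightarrow> 'a"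
    using continuous_on_compose2[OF cont that] by auto
  have cont1: "continuous_on S (\<lambda>x. f' (k x))" if "continuous_on S k" for S and k :: "'c::topological_space \<Rightarrow> 'a"
  proof -
    have "continuous_on UNIV f'" using f'' by (meson has_derivative_continuous_on has_derivative_at_withinI)
    then show ?thesis using continuous_on_compose2[OF _ that] by auto
  qed
  have line: "((\<lambda>s. f (z + s *\<^sub>R d)) has_vector_derivative f' (z + s *\<^sub>R d) d) (at s within S)" for z d s S
  proof -
    have "((\<lambda>s. z + s *\<^sub>R d) has_derivative (\<lambda>s. s *\<^sub>R d)) (at s within S)"
      by (auto intro!: derivative_eq_intros)
    from has_derivative_compose[OF this f'] show ?thesis
      by (simp add: has_vector_derivative_def blinfun.scaleR_right)
  qed
  have line': "((\<lambda>s. f' (z + s *\<^sub>R d) e) has_vector_derivative f'' (z + s *\<^sub>R d) d e) (at s within S)" for z d e s S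
  proof -
    have "((\<lambda>s. z + s *\<^sub>R d) has_derivative (\<lambda>s. s *\<^sub>R d)) (at s within S)"
      by (auto intro!: derivative_eq_intros)
    from has_derivative_compose[OF this f'']
    have "((\<lambda>s. f' (z + s *\<^sub>R d)) has_derivative (\<lambda>x. x *\<^sub>R f'' (z + s *\<^sub>R d) d)) (at s within S)"
      by (simp add: blinfun.scaleR_right)
    from bounded_linear.has_derivative[OF blinfun.bounded_linear_left this] show ?thesis
      by (simp add: has_vector_derivative_def blinfun.scaleR_left)
  qed
  \<comment> \<open>The derivative at \<open>s = 0\<close> of \<open>f (p + s *\<^sub>R u + \<tau>
    *\<^sub>R w) - f (p + s *\<^sub>R u)\<close> is computed in two ways: directly, and under the
    integral that represents the difference.\<close>
  have eq: "integral {0..\<tau>} (\<lambda>\<sigma>. f'' (p + \<sigma> *\<^sub>R w) u w) = f' (p + \<tau> *\<^sub>R w) u - f' p u"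
    if "\<tau> \<in> {0..1}" for \<tau>
  proof -
    have i: "((\<lambda>\<sigma>. f' ((p + s *\<^sub>R u) + \<sigma> *\<^sub>R w) w) has_integral
        f ((p + s *\<^sub>R u) + \<tau> *\<^sub>R w) - f ((p + s *\<^sub>R u) + 0 *\<^sub>R w)) {0..\<tau>}" for s
      by (rule fundamental_theorem_of_calculus[OF _ line]) (use that in auto)
    have "((\<lambda>s. integral (cbox 0 \<tau>) (\<lambda>\<sigma>. f' ((p + \<sigma> *\<^sub>R w) + s *\<^sub>R u) w)) has_vector_derivative
        integral (cbox 0 \<tau>) (\<lambda>\<sigma>. f'' ((p + \<sigma> *\<^sub>R w) + 0 *\<^sub>R u) u w)) (at 0 within UNIV)"
    proof (rule leibniz_rule_vector_derivative)
      show "(\<lambda>\<sigma>. f' ((p + \<sigma> *\<^sub>R w) + s *\<^sub>R u) w) integrable_on cbox 0 \<tau>" for s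
        by (intro integrable_continuous continuous_intros cont1)
      show "continuous_on (UNIV \<times> cbox 0 \<tau>) (\<lambda>(s, \<sigma>). f'' ((p + \<sigma> *\<^sub>R w) + s *\<^sub>R u) u w)"
        unfolding split_beta by (intro continuous_intros cont')
    next
      fix s \<sigma>
      show "((\<lambda>s. f' (p + \<sigma> *\<^sub>R w + s *\<^sub>R u) w) has_vector_derivative
          f'' (p + \<sigma> *\<^sub>R w + s *\<^sub>R u) u w) (at s within UNIV)"
        by (rule line')
    qed auto
    moreover have "integral (cbox 0 \<tau>) (\<lambda>\<sigma>. f' ((p + \<sigma> *\<^sub>R w) + s *\<^sub>R u) w)
        = f ((p + \<tau> *\<^sub>R w) + s *\<^sub>R u) - f (p + s *\<^sub>R u)" for s
      using integral_unique[OF i[of s]] by (simp add: algebra_simps)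
    ultimately have "((\<lambda>s. f ((p + \<tau> *\<^sub>R w) + s *\<^sub>R u) - f (p + s *\<^sub>R u)) has_vector_derivative
        integral (cbox 0 \<tau>) (\<lambda>\<sigma>. f'' (p + \<sigma> *\<^sub>R w) u w)) (at 0)"
      by simp
    moreover have "((\<lambda>s. f ((p + \<tau> *\<^sub>R w) + s *\<^sub>R u) - f (p + s *\<^sub>R u)) has_vector_derivative
        f' ((p + \<tau> *\<^sub>R w) + 0 *\<^sub>R u) u - f' (p + 0 *\<^sub>R u) u) (at 0)"
      by (intro has_vector_derivative_diff line)
    ultimately have "integral (cbox 0 \<tau>) (\<lambda>\<sigma>. f'' (p + \<sigma> *\<^sub>R w) u w)
        = f' ((p + \<tau> *\<^sub>R w) + 0 *\<^sub>R u) u - f' (p + 0 *\<^sub>R u) u"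
      by (rule vector_derivative_unique_at)
    then show ?thesis by simp
  qed
  \<comment> \<open>Both sides of \<open>eq\<close> are differentiated at \<tau> = 0. The derivative
    is one-sided, but still unique at the end of a nondegenerate interval.\<close>
  have "((\<lambda>\<tau>. integral {0..\<tau>} (\<lambda>\<sigma>. f'' (p + \<sigma> *\<^sub>R w) u w)) has_vector_derivative
      f'' (p + 0 *\<^sub>R w) u w) (at 0 within {0..1})"
    by (rule integral_has_vector_derivative) (auto intro!: continuous_intros cont')
  then have "((\<lambda>\<tau>. f' (p + \<tau> *\<^sub>R w) u - f' p u) has_vector_derivative
      f'' (p + 0 *\<^sub>R w) u w) (at 0 within {0..1})"
    by (rule has_vector_derivative_transform[rotated 2]) (auto simp: eq)
  moreover have "((\<lambda>\<tau>. f' (p + \<tau> *\<^sub>R w) u - f' p u) has_vector_derivative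
      f'' (p + 0 *\<^sub>R w) w u - 0) (at 0 within {0..1})"
    by (intro has_vector_derivative_diff line' has_vector_derivative_const)
  ultimately have "f'' (p + 0 *\<^sub>R w) u w = f'' (p + 0 *\<^sub>R w) w u - 0"
    by (intro vector_derivative_unique_within_closed_interval[of 0 1 0]) auto
  then show ?thesis by simp
qed

section \<open>Twice differentiable curves, velocities and momenta\<close>

text \<open>A common class for exact solutions and Galerkin curves, stated through
  \<open>velocity\<close> so that derivatives are those within the closed interval. It yields
  continuous velocities and differentiable momenta.\<close>

definition twice_differentiable_curve :: "real \<Rightarrow> (real \<Rightarrow> 'a::real_normed_vector) \<Rightarrow> bool" where
  "twice_differentiable_curve T q \<longleftrightarrow> (\<forall>t\<in>{0..T}.
     (q has_vector_derivative velocity T q t) (at t within {0..T}) \<and>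
     (velocity T q has_vector_derivative velocity T (velocity T q) t) (at t within {0..T}))"

lemma velocity_eq:
  fixes q :: "real \<Rightarrow> 'a::euclidean_space"
  assumes "T > 0" "t \<in> {0..T}" "(q has_vector_derivative v) (at t within {0..T})"
  shows "velocity T q t = v"
  unfolding velocity_def using vector_derivative_within_closed_interval[OF assms(1) assms(2,3)] .

lemma twice_differentiable_curveI:
  fixes q :: "real \<Rightarrow> 'a::euclidean_space"
  assumes T: "T > 0"
    and v: "\<And>t. t \<in> {0..T} \<Longrightarrow> (q has_vector_derivative v t) (at t within {0..T})"
    and w: "\<And>t. t \<in> {0..T} \<Longrightarrow> (v has_vector_derivative w t) (at t within {0..T})"
  shows "twice_differentiable_curve T q"
  unfolding twice_differentiable_curve_def
proof (intro ballI conjI)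
  fix t assume t: "t \<in> {0..T}"
  have vel: "velocity T q s = v s" if "s \<in> {0..T}" for s
    using velocity_eq[OF T that v[OF that]] .
  then show "(q has_vector_derivative velocity T q t) (at t within {0..T})"
    using v t by simp
  have "(velocity T q has_vector_derivative w t) (at t within {0..T})"
    by (rule has_vector_derivative_transform[OF t _ w[OF t]]) (simp add: vel)
  then show "(velocity T q has_vector_derivative velocity T (velocity T q) t) (at t within {0..T})"
    using velocity_eq[OF T t] by metis
qed

lemma C2_on_twice_differentiable_curve:
  fixes q :: "real \<Rightarrow> 'a::euclidean_space"
  assumes T: "T > 0" and q: "C2_on {0..T} q"
  shows "twice_differentiable_curve T q"
proof -
  obtain f' :: "real \<Rightarrow> real \<Rightarrow>\<^sub>L 'a" and f''
    where f': "\<And>t. t \<in> {0..T} \<Longrightarrow> (q has_derivative blinfun_apply (f' t)) (at t within {0..T})"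
      and f'': "\<And>t. t \<in> {0..T} \<Longrightarrow> (f' has_derivative blinfun_apply (f'' t)) (at t within {0..T})"
    using q unfolding C2_on_def by metis
  \<comment> \<open>On the real line a linear map is multiplication by its value at 1, so
    \<open>f' t 1\<close> is the velocity and \<open>f'' t 1 1\<close> the acceleration.\<close>
  have scale: "f' t c = c *\<^sub>R f' t 1" "f'' t c = c *\<^sub>R f'' t 1" for t c
    using blinfun.scaleR_right[of "f' t" c 1] blinfun.scaleR_right[of "f'' t" c 1] by auto
  show ?thesis
  proof (rule twice_differentiable_curveI[OF T])
    fix t assume t: "t \<in> {0..T}"
    have "blinfun_apply (f' t) = (\<lambda>c. c *\<^sub>R f' t 1)"
      by (rule ext) (rule scale)
    then show "(q has_vector_derivative f' t 1) (at t within {0..T})"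
      using f'[OF t] unfolding has_vector_derivative_def by metis
    have "((\<lambda>s. f' s 1) has_derivative (\<lambda>c. f'' t c 1)) (at t within {0..T})"
      by (rule bounded_linear.has_derivative[OF blinfun.bounded_linear_left f''[OF t]])
    moreover have "(\<lambda>c. f'' t c 1) = (\<lambda>c. c *\<^sub>R f'' t 1 1)"
    proof
      show "f'' t c 1 = c *\<^sub>R f'' t 1 1" for c
        using scale(2)[of t c] by (simp add: blinfun.scaleR_left)
    qed
    ultimately show "((\<lambda>s. f' s 1) has_vector_derivative f'' t 1 1) (at t within {0..T})"
      by (simp only: has_vector_derivative_def)
  qed
qed

lemma twice_differentiable_curve_velocity:
  "twice_differentiable_curve T q \<Longrightarrow> t \<in> {0..T} \<Longrightarrow>
     (q has_vector_derivative velocity T q t) (at t within {0..T})"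
  unfolding twice_differentiable_curve_def by blast

lemma twice_differentiable_curve_continuous:
  assumes "twice_differentiable_curve T q"
  shows "continuous_on {0..T} q" "continuous_on {0..T} (velocity T q)"
  using assms unfolding twice_differentiable_curve_def
  by (auto intro!: continuous_on_vector_derivative)

text \<open>This is the chain rule through \<open>grad2 L\<close>. It is needed for Galerkin curves,
  whose momentum comes with no Euler-Lagrange equation that would supply a derivative.\<close>

lemma momentum_has_vector_derivative:
  fixes L :: "'a::euclidean_space \<Rightarrow> 'a \<Rightarrow> real"
  assumes L: "C2_on UNIV (\<lambda>(x, v). L x v)" and T: "T > 0"
    and q: "twice_differentiable_curve T q" and t: "t \<in> {0..T}"
  shows "(momentum L T q has_vector_derivative velocity T (momentum L T q) t) (at t within {0..T})"
proof -
  obtain D where D: "((\<lambda>(x, v). grad2 L x v) has_derivative D) (at (q t, velocity T q t))"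
    using C2_on_grad2_differentiable[OF L] unfolding differentiable_def by blast
  have "((\<lambda>t. (q t, velocity T q t)) has_vector_derivative (velocity T q t, velocity T (velocity T q) t))
      (at t within {0..T})"
    using q t unfolding twice_differentiable_curve_def by (auto intro: has_vector_derivative_Pair)
  from has_derivative_compose[OF this[unfolded has_vector_derivative_def] D]
  have der: "(momentum L T q has_derivative
      (\<lambda>x. D (x *\<^sub>R (velocity T q t, velocity T (velocity T q) t)))) (at t within {0..T})"
    unfolding momentum_def[abs_def] by simp
  have scale: "D (x *\<^sub>R w) = x *\<^sub>R D w" for x w
    using D has_derivative_linear linear_scale by blast
  have "(momentum L T q has_vector_derivative D (velocity T q t, velocity T (velocity T q) t))
      (at t within {0..T})"
    using der unfolding has_vector_derivative_def scale .
  then show ?thesis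
    using velocity_eq[OF T t] by fastforce
qed

section \<open>Galerkin curves and quadrature\<close>

lemma galerkin_method_basis:
  assumes "galerkin_method G" "i \<in> {1..gdim G}"
  shows "twice_differentiable_curve (gstep G) (gbasis G i)"
  using assms C2_on_twice_differentiable_curve unfolding galerkin_method_def by blast

lemma galerkin_method_node:
  assumes "galerkin_method G" "j \<in> {1..qsize G}"
  shows "qnode G j * gstep G \<in> {0..gstep G}"
  using assms unfolding galerkin_method_def by (auto simp: mult_le_cancel_right1)

lemma
  fixes \<xi> :: "nat \<Rightarrow> 'a::euclidean_space"
  assumes G: "galerkin_method G"
  shows velocity_galerkin_curve: "t \<in> {0..gstep G} \<Longrightarrow> velocity (gstep G) (galerkin_curve G \<xi>) t
          = (\<Sum>i=1..gdim G. velocity (gstep G) (gbasis G i) t *\<^sub>R \<xi> i)"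
    and twice_differentiable_galerkin_curve:
      "twice_differentiable_curve (gstep G) (galerkin_curve G \<xi>)"
proof -
  have T: "gstep G > 0" using G unfolding galerkin_method_def by blast
  have sum: "((\<lambda>t. \<Sum>i=1..gdim G. f i t *\<^sub>R \<xi> i) has_vector_derivative
      (\<Sum>i=1..gdim G. f' i *\<^sub>R \<xi> i)) (at t within S)"
    if "\<And>i. i \<in> {1..gdim G} \<Longrightarrow> (f i has_vector_derivative f' i) (at t within S)"
    for f :: "nat \<Rightarrow> real \<Rightarrow> real" and f' t S
    by (intro has_vector_derivative_sum bounded_linear.has_vector_derivative[OF bounded_linear_scaleR_left] that)
  have 1: "(galerkin_curve G \<xi> has_vector_derivative
      (\<Sum>i=1..gdim G. velocity (gstep G) (gbasis G i) t *\<^sub>R \<xi> i)) (at t within {0..gstep G})"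
    if "t \<in> {0..gstep G}" for t
    unfolding galerkin_curve_def[abs_def]
    using galerkin_method_basis[OF G] that unfolding twice_differentiable_curve_def
    by (intro sum) blast
  have 2: "((\<lambda>t. \<Sum>i=1..gdim G. velocity (gstep G) (gbasis G i) t *\<^sub>R \<xi> i) has_vector_derivative
      (\<Sum>i=1..gdim G. velocity (gstep G) (velocity (gstep G) (gbasis G i)) t *\<^sub>R \<xi> i))
      (at t within {0..gstep G})"
    if "t \<in> {0..gstep G}" for t
    using galerkin_method_basis[OF G] that unfolding twice_differentiable_curve_def
    by (intro sum) blast
  show "twice_differentiable_curve (gstep G) (galerkin_curve G \<xi>)"
    by (rule twice_differentiable_curveI[OF T 1 2])
  show "t \<in> {0..gstep G} \<Longrightarrow> velocity (gstep G) (galerkin_curve G \<xi>) t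
          = (\<Sum>i=1..gdim G. velocity (gstep G) (gbasis G i) t *\<^sub>R \<xi> i)"
    using velocity_eq[OF T _ 1] .
qed

lemma galerkin_curve_add_scaleR:
  "galerkin_curve G (\<lambda>i. \<xi> i + c *\<^sub>R \<eta> i) t = galerkin_curve G \<xi> t + c *\<^sub>R galerkin_curve G \<eta> t"
  unfolding galerkin_curve_def
  by (simp add: algebra_simps sum.distrib scaleR_sum_right)

lemma galerkin_curve_cong:
  "(\<And>i. i \<in> {1..gdim G} \<Longrightarrow> \<xi> i = \<eta> i) \<Longrightarrow> galerkin_curve G \<xi> = galerkin_curve G \<eta>"
  unfolding galerkin_curve_def[abs_def] by simp

text \<open>Linear independence is postulated for real coefficients; taking coordinates transfers it
  to vector coefficients.\<close>

lemma galerkin_curve_eq_0: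
  fixes \<xi> :: "nat \<Rightarrow> 'a::euclidean_space"
  assumes G: "galerkin_method G" and z: "\<And>t. t \<in> {0..gstep G} \<Longrightarrow> galerkin_curve G \<xi> t = 0"
    and i: "i \<in> {1..gdim G}"
  shows "\<xi> i = 0"
proof (rule euclidean_eqI)
  fix b :: 'a assume "b \<in> Basis"
  have "(\<Sum>i=1..gdim G. (\<xi> i \<bullet> b) * gbasis G i t) = 0" if "t \<in> {0..gstep G}" for t
  proof -
    have "(\<Sum>i=1..gdim G. (\<xi> i \<bullet> b) * gbasis G i t) = galerkin_curve G \<xi> t \<bullet> b"
      by (simp add: galerkin_curve_def inner_sum_left mult.commute)
    then show ?thesis using z[OF that] by simp
  qed
  then have "\<xi> i \<bullet> b = 0"
    using G[unfolded galerkin_method_def, THEN conjunct2, THEN conjunct2, THEN conjunct2, THEN conjunct1,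
        rule_format, of "\<lambda>i. \<xi> i \<bullet> b"] i by blast
  then show "\<xi> i \<bullet> b = 0 \<bullet> b" by simp
qed

lemma quadrature_cong:
  assumes "galerkin_method G" "\<And>t. t \<in> {0..gstep G} \<Longrightarrow> f t = f' t"
  shows "quadrature G f = quadrature G f'"
  unfolding quadrature_def using galerkin_method_node[OF assms(1)] assms(2) by simp

lemma quadrature_diff: "quadrature G (\<lambda>t. f t - f' t) = quadrature G f - quadrature G f'"
  unfolding quadrature_def by (simp add: algebra_simps sum_subtractf)

lemma quadrature_inner_left: "quadrature G (\<lambda>t. e \<bullet> f t) = e \<bullet> quadrature G f"
  unfolding quadrature_def by (simp add: inner_sum_right)

section \<open>The discrete action: first variation, continuity and stationarity\<close>

lemma velocity_add_scaleR:
  fixes q \<delta> :: "real \<Rightarrow> 'a::euclidean_space"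
  assumes "T > 0" "twice_differentiable_curve T q" "twice_differentiable_curve T \<delta>" "t \<in> {0..T}"
  shows "velocity T (\<lambda>t. q t + c *\<^sub>R \<delta> t) t = velocity T q t + c *\<^sub>R velocity T \<delta> t"
  by (rule velocity_eq[OF assms(1,4)])
    (intro has_vector_derivative_add twice_differentiable_curve_velocity assms
      bounded_linear.has_vector_derivative[OF bounded_linear_scaleR_right])

text \<open>Quadrature is a finite sum, so differentiation is done node by node. For variations
  \<open>gbasis G 1 t *\<^sub>R e\<close> the right-hand side becomes the quadrature of the Noether
  integrand, paired with \<open>e\<close>.\<close>

lemma discrete_action_has_derivative:
  fixes L :: "'a::euclidean_space \<Rightarrow> 'a \<Rightarrow> real"
  assumes L: "C2_on UNIV (\<lambda>(x, v). L x v)" and G: "galerkin_method G"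
    and q: "twice_differentiable_curve (gstep G) q" and \<delta>: "twice_differentiable_curve (gstep G) \<delta>"
  shows "((\<lambda>\<epsilon>. discrete_action L G (\<lambda>t. q t + \<epsilon> *\<^sub>R \<delta> t)) has_real_derivative
           quadrature G (\<lambda>t. \<delta> t \<bullet> grad1 L (q t) (velocity (gstep G) q t)
             + velocity (gstep G) \<delta> t \<bullet> grad2 L (q t) (velocity (gstep G) q t))) (at 0)"
proof -
  have T: "gstep G > 0" using G unfolding galerkin_method_def by blast
  have "((\<lambda>\<epsilon>. L (q t + \<epsilon> *\<^sub>R \<delta> t) (velocity (gstep G) q t + \<epsilon> *\<^sub>R velocity (gstep G) \<delta> t))
      has_real_derivative \<delta> t \<bullet> grad1 L (q t) (velocity (gstep G) q t)
             + velocity (gstep G) \<delta> t \<bullet> grad2 L (q t) (velocity (gstep G) q t)) (at 0)"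
    (is "(?F has_real_derivative ?d) _") for t
  proof -
    let ?c = "\<lambda>\<epsilon>. (q t + \<epsilon> *\<^sub>R \<delta> t, velocity (gstep G) q t + \<epsilon> *\<^sub>R velocity (gstep G) \<delta> t)"
    have c: "(?c has_derivative (\<lambda>\<epsilon>. (\<epsilon> *\<^sub>R \<delta> t, \<epsilon> *\<^sub>R velocity (gstep G) \<delta> t))) (at 0)"
      by (auto intro!: derivative_eq_intros has_derivative_Pair)
    have "((\<lambda>(x, v). L x v) has_derivative (\<lambda>(u, w). u \<bullet> grad1 L (q t) (velocity (gstep G) q t)
        + w \<bullet> grad2 L (q t) (velocity (gstep G) q t))) (at (?c 0))"
      using differentiable_has_derivative_grad[OF C2_on_UNIV_differentiable[OF L]] by simp
    from has_derivative_compose[OF c this]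
    show ?thesis
      unfolding has_field_derivative_def prod.case
      by (rule has_derivative_eq_rhs) (auto simp: algebra_simps)
  qed
  then have "((\<lambda>\<epsilon>. quadrature G (\<lambda>t. L (q t + \<epsilon> *\<^sub>R \<delta> t)
        (velocity (gstep G) q t + \<epsilon> *\<^sub>R velocity (gstep G) \<delta> t))) has_real_derivative
      quadrature G (\<lambda>t. \<delta> t \<bullet> grad1 L (q t) (velocity (gstep G) q t)
             + velocity (gstep G) \<delta> t \<bullet> grad2 L (q t) (velocity (gstep G) q t))) (at 0)"
    unfolding quadrature_def real_scaleR_def by (intro DERIV_cmult DERIV_sum)
  moreover have "discrete_action L G (\<lambda>t. q t + \<epsilon> *\<^sub>R \<delta> t) = quadrature G (\<lambda>t. L (q t + \<epsilon> *\<^sub>R \<delta> t)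
        (velocity (gstep G) q t + \<epsilon> *\<^sub>R velocity (gstep G) \<delta> t))" for \<epsilon>
    unfolding discrete_action_def using velocity_add_scaleR[OF T q \<delta>]
    by (intro quadrature_cong[OF G]) simp
  ultimately show ?thesis by simp
qed

text \<open>Positions and velocities at the finitely many nodes are linear in the coefficients, so
  continuity of \<open>L\<close> suffices, for coefficients depending on a point of any topological
  space.\<close>

lemma continuous_on_discrete_action_galerkin_curve:
  fixes L :: "'a::euclidean_space \<Rightarrow> 'a \<Rightarrow> real" and Z :: "'b::topological_space \<Rightarrow> nat \<Rightarrow> 'a"
  assumes L: "C2_on UNIV (\<lambda>(x, v). L x v)" and G: "galerkin_method G"
    and Z: "\<And>i. i \<in> {1..gdim G} \<Longrightarrow> continuous_on S (\<lambda>z. Z z i)"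
  shows "continuous_on S (\<lambda>z. discrete_action L G (galerkin_curve G (Z z)))"
proof -
  have "continuous_on UNIV (\<lambda>(x, v). L x v)"
    unfolding continuous_on_eq_continuous_within
    by (intro ballI differentiable_imp_continuous_within C2_on_UNIV_differentiable[OF L])
  then have comp: "continuous_on S (\<lambda>z. L (x z) (v z))"
    if "continuous_on S x" "continuous_on S v" for x v
    using continuous_on_compose2[of UNIV "\<lambda>(x, v). L x v" S "\<lambda>z. (x z, v z)"]
      continuous_on_Pair[OF that] by simp
  have "discrete_action L G (galerkin_curve G (Z z)) = quadrature G (\<lambda>t. L
      (\<Sum>i=1..gdim G. gbasis G i t *\<^sub>R Z z i)
      (\<Sum>i=1..gdim G. velocity (gstep G) (gbasis G i) t *\<^sub>R Z z i))" for z
    unfolding discrete_action_def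
    by (rule quadrature_cong[OF G])
      (simp only: velocity_galerkin_curve[OF G], simp add: galerkin_curve_def)
  then show ?thesis
    by (simp only: quadrature_def) (intro continuous_intros comp Z)
qed

text \<open>Fermat's criterion is applied along each admissible direction separately. The range of
  \<epsilon> may depend on \<delta>, so minimality in a bounded set of coefficients can be used as
  well as global minimality.\<close>

lemma discrete_stationaryI:
  fixes L :: "'a::euclidean_space \<Rightarrow> 'a \<Rightarrow> real"
  assumes L: "C2_on UNIV (\<lambda>(x, v). L x v)" and G: "galerkin_method G"
    and q: "q \<in> galerkin_space G" "q 0 = x" "q (gstep G) = y"
    and min: "\<And>\<delta>. \<delta> \<in> galerkin_space G \<Longrightarrow> \<delta> 0 = 0 \<Longrightarrow> \<delta> (gstep G) = 0 \<Longrightarrow>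
      \<forall>\<^sub>F \<epsilon> in nhds 0. discrete_action L G q \<le> discrete_action L G (\<lambda>t. q t + \<epsilon> *\<^sub>R \<delta> t)"
  shows "discrete_stationary L G x y q"
  unfolding discrete_stationary_def
proof (intro conjI q ballI impI)
  fix \<delta> :: "real \<Rightarrow> 'a" assume \<delta>: "\<delta> \<in> galerkin_space G" and \<delta>0: "\<delta> 0 = 0 \<and> \<delta> (gstep G) = 0"
  let ?A = "\<lambda>\<epsilon>. discrete_action L G (\<lambda>t. q t + \<epsilon> *\<^sub>R \<delta> t)"
  obtain d where d: "(?A has_real_derivative d) (at 0)"
    using discrete_action_has_derivative[OF L G] twice_differentiable_galerkin_curve[OF G] q(1) \<delta>
    unfolding galerkin_space_def by blast
  obtain r where "r > 0" "\<And>\<epsilon>. \<bar>\<epsilon>\<bar> < r \<Longrightarrow> discrete_action L G q \<le> ?A \<epsilon>"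
    using min[OF \<delta>] \<delta>0 unfolding eventually_nhds_metric dist_real_def by auto
  then have "d = 0"
    by (intro DERIV_local_min[OF d, of r]) auto
  then show "(?A has_real_derivative 0) (at 0)" using d by simp
qed

lemma discrete_minimizer_stationary:
  fixes L :: "'a::euclidean_space \<Rightarrow> 'a \<Rightarrow> real"
  assumes L: "C2_on UNIV (\<lambda>(x, v). L x v)" and G: "galerkin_method G"
    and q: "discrete_minimizer L G x y q"
  shows "discrete_stationary L G x y q"
proof (rule discrete_stationaryI[OF L G])
  fix \<delta> :: "real \<Rightarrow> 'a" assume \<delta>: "\<delta> \<in> galerkin_space G" "\<delta> 0 = 0" "\<delta> (gstep G) = 0"
  have "(\<lambda>t. q t + \<epsilon> *\<^sub>R \<delta> t) \<in> galerkin_space G" for \<epsilon>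
    using q \<delta>(1) unfolding discrete_minimizer_def galerkin_space_def
    by (auto simp: galerkin_curve_add_scaleR[symmetric])
  then show "\<forall>\<^sub>F \<epsilon> in nhds 0. discrete_action L G q \<le> discrete_action L G (\<lambda>t. q t + \<epsilon> *\<^sub>R \<delta> t)"
    using q \<delta> unfolding discrete_minimizer_def by (intro always_eventually) auto
qed (use q in \<open>auto simp: discrete_minimizer_def\<close>)

lemma Ld_eq:
  assumes "(x, y) \<in> Ld_domain L G" "discrete_stationary L G x y q"
  shows "Ld L G x y = discrete_action L G q"
proof -
  have "\<exists>!q. discrete_stationary L G x y q"
    using assms(1) by (simp add: Ld_domain_def)
  then have "(THE q. discrete_stationary L G x y q) = q"
    using assms(2) by blast
  then show ?thesis
    by (simp add: Ld_def)
qed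

section \<open>The envelope theorem for the discrete Lagrangian\<close>

text \<open>At the parameter \<open>a\<close> the gap attains a positive minimum \<open>m\<close> on
  the compact set. By compactness the gap changes by at most \<open>m / 2\<close> uniformly on
  \<open>B\<close> when the parameter is close to \<open>a\<close>.\<close>

lemma eventually_less_on_compact:
  fixes f :: "'a::topological_space \<times> 'b::topological_space \<Rightarrow> real"
  assumes f: "continuous_on UNIV f" and B: "compact B"
    and less: "\<And>b. b \<in> B \<Longrightarrow> f (a, z) < f (a, b)"
  shows "\<forall>\<^sub>F x in nhds a. \<forall>b\<in>B. f (x, z) < f (x, b)"
proof (cases "B = {}")
  case False
  let ?g = "\<lambda>(x, b). f (x, b) - f (x, z)"
  have g: "continuous_on (UNIV \<times> B) ?g"
    unfolding split_beta by (intro continuous_intros continuous_on_compose2[OF f]) auto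
  have "continuous_on B (\<lambda>b. f (a, b) - f (a, z))"
    by (intro continuous_intros continuous_on_compose2[OF f]) auto
  then obtain b where b: "b \<in> B" "\<And>b'. b' \<in> B \<Longrightarrow> f (a, b) - f (a, z) \<le> f (a, b') - f (a, z)"
    using continuous_attains_inf[OF B False] by blast
  define m where "m = f (a, b) - f (a, z)"
  have "m > 0" using less[OF b(1)] by (simp add: m_def)
  then obtain X where X: "a \<in> X" "open X"
    "\<forall>x\<in>X \<inter> UNIV. \<forall>b\<in>B. dist (?g (x, b)) (?g (a, b)) \<le> m / 2"
    by (rule continuous_on_prod_compactE[OF g B UNIV_I half_gt_zero])
  have "\<forall>\<^sub>F x in nhds a. x \<in> X"
    using X by (simp add: eventually_nhds_in_open)
  then show ?thesis
  proof eventually_elim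
    case (elim x)
    show ?case
    proof
      fix b' assume b': "b' \<in> B"
      have "\<bar>(f (x, b') - f (x, z)) - (f (a, b') - f (a, z))\<bar> \<le> m / 2"
        using X(3) elim b' by (auto simp: dist_real_def)
      moreover have "f (a, b') - f (a, z) \<ge> m" using b(2)[OF b'] by (simp add: m_def)
      ultimately show "f (x, z) < f (x, b')" using \<open>m > 0\<close> by linarith
    qed
  qed
qed simp

text \<open>Coefficients are functions on all natural numbers. Radius 0 outside \<open>I\<close>
  fixes the irrelevant ones, and the set becomes a product of compact balls, compact by Tychonoff's
  theorem.\<close>

lemma compact_coefficients:
  "compact {\<eta> :: nat \<Rightarrow> 'a::euclidean_space. \<forall>i. norm (\<eta> i) \<le> (if i \<in> I then 1 else 0)}"
proof -
  have "compactin euclidean (PiE UNIV (\<lambda>i. cball (0::'a) (if i \<in> I then 1 else 0)))"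
    unfolding euclidean_product_topology[symmetric] by (subst compactin_PiE) simp
  moreover have "PiE UNIV (\<lambda>i. cball (0::'a) (if i \<in> I then 1 else 0))
      = {\<eta>. \<forall>i. norm (\<eta> i) \<le> (if i \<in> I then 1 else 0)}"
    by (auto simp: PiE_def Pi_def)
  ultimately show ?thesis by simp
qed

text \<open>The discrete Lagrangian is only known to be a stationary value, and the stationary curve is
  not assumed to depend continuously on its end points. Still, the unique stationary curve at
  \<open>(x, y)\<close> is a strict minimizer, so it lies strictly below a compact sphere around it; this
  persists under small perturbations of \<open>x\<close> and forces a minimizer inside the ball. That interior
  minimizer is stationary, hence it is the curve defining the discrete Lagrangian.\<close>

lemma Ld_le_perturbed:
  fixes L :: "'a::euclidean_space \<Rightarrow> 'a \<Rightarrow> real"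
  assumes L: "C2_on UNIV (\<lambda>(x, v). L x v)" and G: "galerkin_method G"
    and \<phi>: "gbasis G 1 0 = 1" "gbasis G 1 (gstep G) = 0"
    and dom: "(x, y) \<in> interior (Ld_domain L G)"
    and min: "discrete_minimizer L G x y q"
  shows "\<forall>\<^sub>F \<epsilon> in nhds 0. Ld L G (x + \<epsilon> *\<^sub>R e) y
           \<le> discrete_action L G (\<lambda>t. q t + \<epsilon> *\<^sub>R (gbasis G 1 t *\<^sub>R e))"
proof -
  \<comment> \<open>These are the coefficients of the variation
    \<open>gbasis G 1 t *\<^sub>R e\<close>, which moves the left end point by \<open>e\<close> and
    leaves the right one fixed.\<close>
  define \<kappa> where "\<kappa> = (\<lambda>i::nat. if i = 1 then e else 0)"
  obtain \<zeta> where q: "q = galerkin_curve G \<zeta>"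
    using min unfolding discrete_minimizer_def galerkin_space_def by blast
  have \<kappa>: "galerkin_curve G \<kappa> t = gbasis G 1 t *\<^sub>R e" for t
  proof -
    have "galerkin_curve G \<kappa> t = (\<Sum>i=1..gdim G. if i = 1 then gbasis G 1 t *\<^sub>R e else 0)"
      unfolding galerkin_curve_def \<kappa>_def by (intro sum.cong) auto
    then show ?thesis using G by (simp add: galerkin_method_def)
  qed
  \<comment> \<open>The parameter \<epsilon> shifts the end point and \<eta> varies the curve. The
    factor 1 gives the sum the form to which \<open>galerkin_curve_add_scaleR\<close> applies
    twice.\<close>
  define Z where "Z = (\<lambda>\<epsilon> \<eta> i. (\<zeta> i + \<epsilon> *\<^sub>R \<kappa> i) + 1 *\<^sub>R \<eta> i)"
  have Z: "galerkin_curve G (Z \<epsilon> \<eta>) t = q t + \<epsilon> *\<^sub>R (gbasis G 1 t *\<^sub>R e) + galerkin_curve G \<eta> t"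
    for \<epsilon> \<eta> t
    unfolding Z_def galerkin_curve_add_scaleR by (simp add: q \<kappa>)
  define F where "F = (\<lambda>(\<epsilon>, \<eta>). discrete_action L G (galerkin_curve G (Z \<epsilon> \<eta>)))"
  have contF: "continuous_on UNIV F"
    unfolding F_def split_beta
    by (intro continuous_on_discrete_action_galerkin_curve[OF L G], unfold Z_def)
      (intro continuous_intros continuous_on_compose2[OF continuous_on_product_coordinates], auto)
  have F0: "F (\<epsilon>, \<lambda>i. 0) = discrete_action L G (\<lambda>t. q t + \<epsilon> *\<^sub>R (gbasis G 1 t *\<^sub>R e))" for \<epsilon>
  proof -
    have "galerkin_curve G (Z \<epsilon> (\<lambda>i. 0)) = (\<lambda>t. q t + \<epsilon> *\<^sub>R (gbasis G 1 t *\<^sub>R e))"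
      using Z[of \<epsilon> "\<lambda>i. 0"] by (simp add: fun_eq_iff galerkin_curve_def)
    then show ?thesis by (simp add: F_def)
  qed
  have cont_curve: "continuous_on UNIV (\<lambda>\<eta> :: nat \<Rightarrow> 'a. galerkin_curve G \<eta> t)" for t
    unfolding galerkin_curve_def by (intro continuous_intros) auto
  \<comment> \<open>Variations with fixed end points, in the unit ball of the maximum norm on
    coefficients; \<open>B\<close> below is the corresponding unit sphere.\<close>
  define K where "K = {\<eta> :: nat \<Rightarrow> 'a. \<forall>i. norm (\<eta> i) \<le> (if i \<in> {1..gdim G} then 1 else 0)}
      \<inter> ({\<eta>. galerkin_curve G \<eta> 0 = 0} \<inter> {\<eta>. galerkin_curve G \<eta> (gstep G) = 0})"
  have K: "compact K"
    unfolding K_def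
    by (intro compact_Int_closed compact_coefficients closed_Int closed_Collect_eq cont_curve continuous_intros)
  define B where "B = K \<inter> (\<Union>i\<in>{1..gdim G}. {\<eta>. norm (\<eta> i) = 1})"
  have "compact B"
  proof -
    have "continuous_on UNIV (\<lambda>\<eta> :: nat \<Rightarrow> 'a. norm (\<eta> i))" for i
      by (intro continuous_on_norm continuous_on_product_coordinates)
    then have "closed {\<eta> :: nat \<Rightarrow> 'a. norm (\<eta> i) = 1}" for i
      by (intro closed_Collect_eq continuous_on_const)
    then show ?thesis
      unfolding B_def by (intro compact_Int_closed K closed_UN) auto
  qed
  have zero: "(\<lambda>i. 0) \<in> K"
    by (simp add: K_def galerkin_curve_def)
  have endpoints: "galerkin_curve G (Z \<epsilon> \<eta>) 0 = x + \<epsilon> *\<^sub>R e"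
    "galerkin_curve G (Z \<epsilon> \<eta>) (gstep G) = y" if "\<eta> \<in> K" for \<epsilon> \<eta>
    using that min \<phi> unfolding Z K_def discrete_minimizer_def by auto
  have unique: "\<exists>!q. discrete_stationary L G x y q"
    using dom interior_subset by (fastforce simp: Ld_domain_def)
  \<comment> \<open>Otherwise the curve for \<eta> would be a second minimizer, hence stationary and
    equal to \<open>q\<close> by uniqueness. All coefficients of \<eta> would vanish, although one
    has norm 1.\<close>
  have strict: "F (0, \<lambda>i. 0) < F (0, \<eta>)" if \<eta>: "\<eta> \<in> B" for \<eta>
  proof (rule ccontr)
    assume "\<not> F (0, \<lambda>i. 0) < F (0, \<eta>)"
    then have "discrete_action L G (galerkin_curve G (Z 0 \<eta>)) \<le> discrete_action L G q"
      using F0[of 0] by (simp add: F_def)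
    moreover have "\<eta> \<in> K" using \<eta> by (simp add: B_def)
    ultimately have "discrete_minimizer L G x y (galerkin_curve G (Z 0 \<eta>))"
      using min endpoints[of \<eta> 0] unfolding discrete_minimizer_def galerkin_space_def by force
    then have "galerkin_curve G (Z 0 \<eta>) = q"
      using unique discrete_minimizer_stationary[OF L G] min by blast
    then have "galerkin_curve G \<eta> t = 0" for t
      using Z[of 0 \<eta> t] by simp
    then have "\<eta> i = 0" if "i \<in> {1..gdim G}" for i
      using galerkin_curve_eq_0[OF G _ that] by blast
    then show False using \<eta> by (auto simp: B_def)
  qed
  have "\<forall>\<^sub>F \<epsilon> in nhds 0. \<forall>\<eta>\<in>B. F (\<epsilon>, \<lambda>i. 0) < F (\<epsilon>, \<eta>)"
    by (rule eventually_less_on_compact[OF contF \<open>compact B\<close> strict])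
  moreover have "\<forall>\<^sub>F \<epsilon> in nhds 0. (x + \<epsilon> *\<^sub>R e, y) \<in> Ld_domain L G"
  proof -
    have "((\<lambda>\<epsilon>. (x + \<epsilon> *\<^sub>R e, y)) \<longlongrightarrow> (x + 0 *\<^sub>R e, y)) (nhds 0)"
      by (intro tendsto_intros filterlim_ident)
    then have "\<forall>\<^sub>F \<epsilon> in nhds 0. (x + \<epsilon> *\<^sub>R e, y) \<in> interior (Ld_domain L G)"
      by (rule topological_tendstoD) (use dom in auto)
    then show ?thesis
      by eventually_elim (use interior_subset in blast)
  qed
  ultimately show ?thesis
  proof eventually_elim
    case (elim \<epsilon>)
    have "continuous_on K (\<lambda>\<eta>. F (\<epsilon>, \<eta>))"
      by (intro continuous_on_compose2[OF contF] continuous_intros) auto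
    then obtain \<eta> where \<eta>: "\<eta> \<in> K" and le: "\<And>\<eta>'. \<eta>' \<in> K \<Longrightarrow> F (\<epsilon>, \<eta>) \<le> F (\<epsilon>, \<eta>')"
      using continuous_attains_inf[OF K, of "\<lambda>\<eta>. F (\<epsilon>, \<eta>)"] zero by blast
    \<comment> \<open>The minimizer over \<open>K\<close> does no worse than the zero variation,
      which is strictly better than every point of the sphere.\<close>
    have "\<eta> \<notin> B"
      using le[OF zero] elim(1) by force
    then have less: "norm (\<eta> i) < 1" if "i \<in> {1..gdim G}" for i
    proof -
      have "norm (\<eta> i) \<noteq> 1" using \<open>\<eta> \<notin> B\<close> \<eta> that by (auto simp: B_def)
      moreover have "norm (\<eta> i) \<le> (if i \<in> {1..gdim G} then 1 else 0)" using \<eta> by (simp add: K_def)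
      ultimately show ?thesis using that by simp
    qed
    have "discrete_stationary L G (x + \<epsilon> *\<^sub>R e) y (galerkin_curve G (Z \<epsilon> \<eta>))"
    proof (rule discrete_stationaryI[OF L G])
      fix \<delta> :: "real \<Rightarrow> 'a"
      assume \<delta>: "\<delta> \<in> galerkin_space G" "\<delta> 0 = 0" "\<delta> (gstep G) = 0"
      then obtain \<mu>' where \<mu>': "\<delta> = galerkin_curve G \<mu>'" unfolding galerkin_space_def by blast
      \<comment> \<open>Truncation to the index range changes no curve and keeps \<eta> + s \<mu>
        zero at the other indices, as membership in \<open>K\<close> demands.\<close>
      define \<mu> where "\<mu> = (\<lambda>i. if i \<in> {1..gdim G} then \<mu>' i else 0)"
      have \<mu>: "\<delta> = galerkin_curve G \<mu>" unfolding \<mu>' \<mu>_def by (rule galerkin_curve_cong) simp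
      have "\<forall>\<^sub>F s in nhds 0. \<forall>i\<in>{1..gdim G}. norm (\<eta> i + s *\<^sub>R \<mu> i) < 1"
      proof (intro eventually_ball_finite ballI)
        fix i assume i: "i \<in> {1..gdim G}"
        have "((\<lambda>s. norm (\<eta> i + s *\<^sub>R \<mu> i)) \<longlongrightarrow> norm (\<eta> i + 0 *\<^sub>R \<mu> i)) (nhds 0)"
          by (intro tendsto_intros filterlim_ident)
        then show "\<forall>\<^sub>F s in nhds 0. norm (\<eta> i + s *\<^sub>R \<mu> i) < 1"
          by (rule order_tendstoD) (use less[OF i] in simp)
      qed simp
      then show "\<forall>\<^sub>F s in nhds 0. discrete_action L G (galerkin_curve G (Z \<epsilon> \<eta>))
          \<le> discrete_action L G (\<lambda>t. galerkin_curve G (Z \<epsilon> \<eta>) t + s *\<^sub>R \<delta> t)"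
      proof eventually_elim
        case (elim s)
        have "\<eta> i + s *\<^sub>R \<mu> i = 0" if "i \<notin> {1..gdim G}" for i
        proof -
          have "norm (\<eta> i) \<le> (if i \<in> {1..gdim G} then 1 else 0)" using \<eta> by (simp add: K_def)
          then show ?thesis using that by (auto simp: \<mu>_def)
        qed
        then have "(\<lambda>i. \<eta> i + s *\<^sub>R \<mu> i) \<in> K"
          using elim \<eta> \<delta> unfolding K_def \<mu> by (auto simp: galerkin_curve_add_scaleR less_imp_le)
        from le[OF this] have "F (\<epsilon>, \<eta>) \<le> F (\<epsilon>, \<lambda>i. \<eta> i + s *\<^sub>R \<mu> i)" .
        moreover have "galerkin_curve G (Z \<epsilon> (\<lambda>i. \<eta> i + s *\<^sub>R \<mu> i))
            = (\<lambda>t. galerkin_curve G (Z \<epsilon> \<eta>) t + s *\<^sub>R \<delta> t)"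
          by (rule ext) (simp add: Z galerkin_curve_add_scaleR \<mu>)
        ultimately show ?case by (simp add: F_def)
      qed
    qed (use endpoints[OF \<eta>] in \<open>auto simp: galerkin_space_def\<close>)
    then have "Ld L G (x + \<epsilon> *\<^sub>R e) y = F (\<epsilon>, \<eta>)"
      using Ld_eq[OF elim(2)] by (simp add: F_def)
    also have "\<dots> \<le> F (\<epsilon>, \<lambda>i. 0)" by (rule le[OF zero])
    finally show ?case by (simp add: F0)
  qed
qed

lemma twice_differentiable_curve_scaleR_left:
  assumes "T > 0" "twice_differentiable_curve T \<phi>"
  shows "twice_differentiable_curve T (\<lambda>t. \<phi> t *\<^sub>R (e :: 'a::euclidean_space))"
    and "t \<in> {0..T} \<Longrightarrow> velocity T (\<lambda>t. \<phi> t *\<^sub>R e) t = velocity T \<phi> t *\<^sub>R e"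
proof -
  have 1: "((\<lambda>t. \<phi> t *\<^sub>R e) has_vector_derivative velocity T \<phi> t *\<^sub>R e) (at t within {0..T})"
    if "t \<in> {0..T}" for t
    using assms that unfolding twice_differentiable_curve_def
    by (intro bounded_linear.has_vector_derivative[OF bounded_linear_scaleR_left]) blast
  show "twice_differentiable_curve T (\<lambda>t. \<phi> t *\<^sub>R e)"
  proof (rule twice_differentiable_curveI[OF assms(1) 1])
    show "((\<lambda>t. velocity T \<phi> t *\<^sub>R e) has_vector_derivative velocity T (velocity T \<phi>) t *\<^sub>R e)
        (at t within {0..T})" if "t \<in> {0..T}" for t
      using assms that unfolding twice_differentiable_curve_def
      by (intro bounded_linear.has_vector_derivative[OF bounded_linear_scaleR_left]) blast
  qed
  show "t \<in> {0..T} \<Longrightarrow> velocity T (\<lambda>t. \<phi> t *\<^sub>R e) t = velocity T \<phi> t *\<^sub>R e"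
    by (rule velocity_eq[OF assms(1) _ 1])
qed

text \<open>The action of \<open>q\<close> perturbed by \<open>gbasis G 1 t *\<^sub>R e\<close>,
  minus \<open>Ld\<close> at the moved end point, is nonnegative near \<epsilon> = 0 and vanishes at
  0. Its derivative is therefore 0, which equates the first variation with
  \<open>e \<bullet> grad1 (Ld L G) x y\<close>.\<close>

lemma grad1_Ld:
  fixes L :: "'a::euclidean_space \<Rightarrow> 'a \<Rightarrow> real"
  assumes L: "C2_on UNIV (\<lambda>(x, v). L x v)" and G: "galerkin_method G"
    and \<phi>: "gbasis G 1 0 = 1" "gbasis G 1 (gstep G) = 0"
    and dom: "(x, y) \<in> interior (Ld_domain L G)"
    and diff: "(\<lambda>(x, y). Ld L G x y) differentiable (at (x, y))"
    and min: "discrete_minimizer L G x y q"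
  shows "grad1 (Ld L G) x y = quadrature G (noether_integrand L G q)"
proof -
  have T: "gstep G > 0" and one: "1 \<in> {1..gdim G}"
    using G unfolding galerkin_method_def by auto
  have "e \<bullet> quadrature G (noether_integrand L G q) = e \<bullet> grad1 (Ld L G) x y" for e
  proof -
    let ?A = "\<lambda>\<epsilon>. discrete_action L G (\<lambda>t. q t + \<epsilon> *\<^sub>R (gbasis G 1 t *\<^sub>R e))"
    let ?Q = "quadrature G (\<lambda>t. e \<bullet> noether_integrand L G q t)"
    note \<phi>e = twice_differentiable_curve_scaleR_left[OF T galerkin_method_basis[OF G one], where e = e]
    have q: "twice_differentiable_curve (gstep G) q"
      using min twice_differentiable_galerkin_curve[OF G]
      unfolding discrete_minimizer_def galerkin_space_def by auto
    have A: "(?A has_real_derivative ?Q) (at 0)"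
    proof (rule DERIV_cong[OF discrete_action_has_derivative[OF L G q \<phi>e(1)] quadrature_cong[OF G]])
      fix t assume "t \<in> {0..gstep G}"
      then show "gbasis G 1 t *\<^sub>R e \<bullet> grad1 L (q t) (velocity (gstep G) q t)
          + velocity (gstep G) (\<lambda>t. gbasis G 1 t *\<^sub>R e) t \<bullet> grad2 L (q t) (velocity (gstep G) q t)
          = e \<bullet> noether_integrand L G q t"
        using \<phi>e(2)[of t] by (simp add: noether_integrand_def inner_add_right)
    qed
    have line: "((\<lambda>\<epsilon>. (x + \<epsilon> *\<^sub>R e, y)) has_derivative (\<lambda>\<epsilon>. (\<epsilon> *\<^sub>R e, 0))) (at 0)"
      by (auto intro!: derivative_eq_intros has_derivative_Pair)
    have "((\<lambda>(x, y). Ld L G x y) has_derivative (\<lambda>(u, v). u \<bullet> grad1 (Ld L G) x y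
        + v \<bullet> grad2 (Ld L G) x y)) (at (x + 0 *\<^sub>R e, y))"
      using differentiable_has_derivative_grad[OF diff] by simp
    from has_derivative_compose[OF line this]
    have D: "((\<lambda>\<epsilon>. Ld L G (x + \<epsilon> *\<^sub>R e) y) has_real_derivative e \<bullet> grad1 (Ld L G) x y) (at 0)"
      unfolding has_field_derivative_def prod.case
      by (rule has_derivative_eq_rhs) (auto simp: mult.commute)
    have "(x, y) \<in> Ld_domain L G" using dom interior_subset by blast
    then have eq: "Ld L G x y = discrete_action L G q"
      by (rule Ld_eq[OF _ discrete_minimizer_stationary[OF L G min]])
    obtain r where r: "r > 0" "\<And>\<epsilon>. \<bar>\<epsilon>\<bar> < r \<Longrightarrow> Ld L G (x + \<epsilon> *\<^sub>R e) y \<le> ?A \<epsilon>"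
      using Ld_le_perturbed[OF L G \<phi> dom min, of e]
      unfolding eventually_nhds_metric dist_real_def by auto
    have "?Q - e \<bullet> grad1 (Ld L G) x y = 0"
      by (rule DERIV_local_min[OF DERIV_diff[OF A D] r(1)]) (use r(2) eq in auto)
    then show ?thesis by (simp add: quadrature_inner_left)
  qed
  then show ?thesis by (metis vector_eq_ldot)
qed

section \<open>Discrete and continuous Noether theorems\<close>

lemma
  assumes g: "one_parameter_group g"
  shows generator_has_vector_derivative:
      "((\<lambda>s. g s x) has_vector_derivative generator g x) (at 0)"
    and one_parameter_group_0: "g 0 x = x"
proof -
  have "(\<lambda>(s, x). g s x) differentiable (at (0, x))"
    using g C2_on_UNIV_differentiable unfolding one_parameter_group_def by blast
  then obtain D where D: "((\<lambda>(s, x). g s x) has_derivative D) (at (0, x))"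
    unfolding differentiable_def by blast
  have "((\<lambda>s. (s, x)) has_derivative (\<lambda>s. (s, 0))) (at 0)"
    by (auto intro!: derivative_eq_intros has_derivative_Pair)
  from has_derivative_compose[OF this D]
  have "(\<lambda>s. g s x) differentiable (at 0)"
    unfolding differentiable_def by auto
  then show "((\<lambda>s. g s x) has_vector_derivative generator g x) (at 0)"
    unfolding generator_def by (simp add: vector_derivative_works)
  show "g 0 x = x" using g by (simp add: one_parameter_group_def)
qed

text \<open>The invariance is differentiated at \<open>s = 0\<close>. It is available only for pairs
  in \<open>Ld_domain\<close>; since the pair is interior, its orbit stays there for small
  \<open>s\<close>.\<close>

lemma discrete_noether:
  fixes L :: "'a::euclidean_space \<Rightarrow> 'a \<Rightarrow> real"
  assumes g: "one_parameter_group g" and inv: "invariant_Ld g L G"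
    and dom: "(x, y) \<in> interior (Ld_domain L G)"
    and diff: "(\<lambda>(x, y). Ld L G x y) differentiable (at (x, y))"
  shows "generator g x \<bullet> grad1 (Ld L G) x y + generator g y \<bullet> grad2 (Ld L G) x y = 0"
proof -
  let ?c = "\<lambda>s. (g s x, g s y)"
  have c: "(?c has_vector_derivative (generator g x, generator g y)) (at 0)"
    by (intro has_vector_derivative_Pair generator_has_vector_derivative[OF g])
  have "((\<lambda>(x, y). Ld L G x y) has_derivative (\<lambda>(u, v). u \<bullet> grad1 (Ld L G) x y
      + v \<bullet> grad2 (Ld L G) x y)) (at (?c 0))"
    using differentiable_has_derivative_grad[OF diff] by (simp add: one_parameter_group_0[OF g])
  from has_derivative_compose[OF c[unfolded has_vector_derivative_def] this]
  have D: "((\<lambda>s. Ld L G (g s x) (g s y)) has_real_derivative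
      generator g x \<bullet> grad1 (Ld L G) x y + generator g y \<bullet> grad2 (Ld L G) x y) (at 0)"
    unfolding has_field_derivative_def prod.case
    by (rule has_derivative_eq_rhs) (auto simp: algebra_simps)
  have "isCont ?c 0"
    using c by (rule has_vector_derivative_continuous)
  then have "(?c \<longlongrightarrow> (x, y)) (at 0)"
    unfolding isCont_def by (simp add: one_parameter_group_0[OF g])
  then have "\<forall>\<^sub>F s in at 0. ?c s \<in> interior (Ld_domain L G)"
    by (rule topological_tendstoD) (use dom in auto)
  then obtain r where r: "r > 0" "\<And>s. s \<noteq> 0 \<Longrightarrow> dist s 0 < r \<Longrightarrow> ?c s \<in> interior (Ld_domain L G)"
    unfolding eventually_at by auto
  have "Ld L G (g 0 x) (g 0 y) = Ld L G (g s x) (g s y)" if "\<bar>0 - s\<bar> < r" for s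
  proof (cases "s = 0")
    case False
    then have "?c s \<in> Ld_domain L G" "(x, y) \<in> Ld_domain L G"
      using r(2)[of s] that dom interior_subset by (auto simp: dist_real_def)
    then show ?thesis
      using inv by (simp add: invariant_Ld_def one_parameter_group_0[OF g])
  qed simp
  then show ?thesis
    by (intro DERIV_local_const[OF D r(1)]) auto
qed

text \<open>Infinitesimal invariance under the tangent lift. The lifted velocity changes at the rate
  of the time derivative of the space derivative of \<open>g\<close>; symmetry of second derivatives
  turns this into the space derivative \<open>A\<close> of the generator.\<close>

lemma generator_invariance:
  fixes L :: "'a::euclidean_space \<Rightarrow> 'a \<Rightarrow> real"
  assumes L: "C2_on UNIV (\<lambda>(x, v). L x v)" and g: "one_parameter_group g"
    and inv: "invariant_lagrangian g L"
  obtains A where "(generator g has_derivative A) (at x)"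
    and "\<And>v. generator g x \<bullet> grad1 L x v + A v \<bullet> grad2 L x v = 0"
proof -
  obtain g' :: "real \<times> 'a \<Rightarrow> (real \<times> 'a) \<Rightarrow>\<^sub>L 'a" and g''
    where g': "\<And>z. ((\<lambda>(s, x). g s x) has_derivative blinfun_apply (g' z)) (at z)"
      and g'': "\<And>z. (g' has_derivative blinfun_apply (g'' z)) (at z)"
      and cont: "continuous_on UNIV g''"
    using g unfolding one_parameter_group_def C2_on_def by auto
  have space: "(g s has_derivative (\<lambda>v. g' (s, y) (0, v))) (at y)" for s y
  proof -
    have "((\<lambda>y. (s, y)) has_derivative (\<lambda>v. (0, v))) (at y)"
      by (auto intro!: derivative_eq_intros has_derivative_Pair)
    from has_derivative_compose[OF this g'] show ?thesis by simp
  qed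
  have time: "((\<lambda>s. (s, y)) has_derivative (\<lambda>s. s *\<^sub>R (1, 0))) (at 0)" for y :: 'a
    by (auto intro!: derivative_eq_intros has_derivative_Pair)
  have "generator g y = g' (0, y) (1, 0)" for y
  proof -
    have "((\<lambda>s. g s y) has_vector_derivative g' (0, y) (1, 0)) (at 0)"
      using has_derivative_compose[OF time g']
      by (simp add: has_vector_derivative_def blinfun.scaleR_right del: scaleR_Pair)
    then show ?thesis
      unfolding generator_def by (rule vector_derivative_at)
  qed
  then have gen: "generator g = (\<lambda>y. g' (0, y) (1, 0))" by auto
  define A where "A v = g'' (0, x) (0, v) (1, 0)" for v
  have "((\<lambda>y. (0, y)) has_derivative (\<lambda>v. (0, v))) (at x)"
    by (auto intro!: derivative_eq_intros has_derivative_Pair)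
  from bounded_linear.has_derivative[OF blinfun.bounded_linear_left has_derivative_compose[OF this g'']]
  have "(generator g has_derivative A) (at x)"
    unfolding gen A_def[abs_def] .
  moreover have "generator g x \<bullet> grad1 L x v + A v \<bullet> grad2 L x v = 0" for v
  proof -
    let ?c = "\<lambda>s. (g s x, g' (s, x) (0, v))"
    have c2: "((\<lambda>s. g' (s, x) (0, v)) has_vector_derivative A v) (at 0)"
    proof -
      have "g'' (0, x) (1, 0) (0, v) = A v"
        unfolding A_def by (rule second_derivative_symmetric[OF g' g'' cont])
      moreover have "((\<lambda>s. g' (s, x) (0, v)) has_derivative (\<lambda>s. g'' (0, x) (s *\<^sub>R (1, 0)) (0, v))) (at 0)"
        by (rule bounded_linear.has_derivative[OF blinfun.bounded_linear_left has_derivative_compose[OF time g'']])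
      ultimately show ?thesis
        by (simp add: has_vector_derivative_def blinfun.scaleR_right blinfun.scaleR_left del: scaleR_Pair)
    qed
    have c: "(?c has_vector_derivative (generator g x, A v)) (at 0)"
      by (intro has_vector_derivative_Pair generator_has_vector_derivative[OF g] c2)
    \<comment> \<open>The lift of the identity is the identity, so the lifted path starts at
      \<open>(x, v)\<close>.\<close>
    have "g 0 = (\<lambda>y. y)" using one_parameter_group_0[OF g] by auto
    then have "((\<lambda>y. y) has_derivative (\<lambda>v. g' (0, x) (0, v))) (at x)"
      using space[of 0 x] by simp
    then have "(\<lambda>v. g' (0, x) (0, v)) = (\<lambda>v. v)"
      by (rule has_derivative_unique) (rule has_derivative_ident)
    then have "g' (0, x) (0, v) = v" by (rule fun_cong)
    then have "((\<lambda>(x, v). L x v) has_derivative (\<lambda>(u, w). u \<bullet> grad1 L x v + w \<bullet> grad2 L x v)) (at (?c 0))"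
      using differentiable_has_derivative_grad[OF C2_on_UNIV_differentiable[OF L]]
      by (simp add: one_parameter_group_0[OF g])
    from has_derivative_compose[OF c[unfolded has_vector_derivative_def] this]
    have D: "((\<lambda>s. L (g s x) (g' (s, x) (0, v))) has_real_derivative
        generator g x \<bullet> grad1 L x v + A v \<bullet> grad2 L x v) (at 0)"
      unfolding has_field_derivative_def prod.case
      by (rule has_derivative_eq_rhs) (auto simp: algebra_simps)
    have "L (g s x) (g' (s, x) (0, v)) = L x v" for s
    proof -
      have "frechet_derivative (g s) (at x) = (\<lambda>v. g' (s, x) (0, v))"
        using frechet_derivative_at[OF space[of s x]] by simp
      moreover have "L (g s x) (frechet_derivative (g s) (at x) v) = L x v"
        using inv unfolding invariant_lagrangian_def by blast
      ultimately show ?thesis by simp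
    qed
    then show ?thesis
      by (intro DERIV_local_const[OF D zero_less_one]) simp
  qed
  ultimately show thesis by (rule that)
qed

text \<open>The Euler-Lagrange equation replaces the derivative of the momentum by
  \<open>grad1 L\<close>; the product rule then yields exactly the expression that vanishes by
  infinitesimal invariance.\<close>

lemma noether_map_conserved:
  fixes L :: "'a::euclidean_space \<Rightarrow> 'a \<Rightarrow> real"
  assumes L: "C2_on UNIV (\<lambda>(x, v). L x v)" and g: "one_parameter_group g"
    and inv: "invariant_lagrangian g L" and T: "T > 0" and q: "euler_lagrange L T q"
    and t: "t \<in> {0..T}"
  shows "noether_map g (momentum L T q t) (q t) = noether_map g (momentum L T q 0) (q 0)"
proof -
  have q': "twice_differentiable_curve T q"
    using q C2_on_twice_differentiable_curve[OF T] unfolding euler_lagrange_def by blast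
  have "((\<lambda>t. noether_map g (momentum L T q t) (q t)) has_vector_derivative 0) (at t within {0..T})"
    if t: "t \<in> {0..T}" for t
  proof -
    obtain A where A: "(generator g has_derivative A) (at (q t))"
      and eq: "generator g (q t) \<bullet> grad1 L (q t) (velocity T q t)
        + A (velocity T q t) \<bullet> grad2 L (q t) (velocity T q t) = 0"
      using generator_invariance[OF L g inv] by metis
    have "A (s *\<^sub>R v) = s *\<^sub>R A v" for s v
      using A has_derivative_linear linear_scale by blast
    then have "((\<lambda>t. generator g (q t)) has_vector_derivative A (velocity T q t)) (at t within {0..T})"
      using has_derivative_compose[OF
          twice_differentiable_curve_velocity[OF q' t, unfolded has_vector_derivative_def] A]
      by (simp add: has_vector_derivative_def)
    moreover have "(momentum L T q has_vector_derivative grad1 L (q t) (velocity T q t)) (at t within {0..T})"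
      using q t unfolding euler_lagrange_def by blast
    ultimately have "((\<lambda>t. momentum L T q t \<bullet> generator g (q t)) has_vector_derivative
        momentum L T q t \<bullet> A (velocity T q t) + grad1 L (q t) (velocity T q t) \<bullet> generator g (q t))
        (at t within {0..T})"
      by (intro bounded_bilinear.has_vector_derivative[OF bounded_bilinear_inner])
    moreover have "momentum L T q t \<bullet> A (velocity T q t)
        + grad1 L (q t) (velocity T q t) \<bullet> generator g (q t) = 0"
      using eq by (simp add: momentum_def inner_commute)
    ultimately show ?thesis by (simp add: noether_map_def)
  qed
  then obtain c where "\<And>t. t \<in> {0..T} \<Longrightarrow> noether_map g (momentum L T q t) (q t) = c"
    by (rule has_vector_derivative_zero_constant[OF convex_real_interval(5)]) blast+
  then show ?thesis using t T by simp
qed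

section \<open>Norm and Lipschitz estimates\<close>

lemma norm_le_Linf_norm:
  assumes "continuous_on {0..h} f" "t \<in> {0..h}"
  shows "norm (f t) \<le> Linf_norm h f"
  unfolding Linf_norm_def
proof (rule cSUP_upper[OF assms(2)])
  have "compact ((\<lambda>t. norm (f t)) ` {0..h})"
    by (intro compact_continuous_image continuous_on_norm assms(1)) simp
  then show "bdd_above ((\<lambda>t. norm (f t)) ` {0..h})"
    by (rule bounded_imp_bdd_above[OF compact_imp_bounded])
qed

lemma velocity_diff:
  fixes q r :: "real \<Rightarrow> 'a::euclidean_space"
  assumes "T > 0" "twice_differentiable_curve T q" "twice_differentiable_curve T r" "t \<in> {0..T}"
  shows "velocity T (\<lambda>t. q t - r t) t = velocity T q t - velocity T r t"
  by (rule velocity_eq[OF assms(1,4)])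
    (intro has_vector_derivative_diff twice_differentiable_curve_velocity assms)

lemma W11_norm_diff:
  fixes q r :: "real \<Rightarrow> 'a::euclidean_space"
  assumes "T > 0" and q: "twice_differentiable_curve T q" and r: "twice_differentiable_curve T r"
  shows "((\<lambda>t. norm (q t - r t) + norm (velocity T q t - velocity T r t)) has_integral
           W11_norm T (\<lambda>t. q t - r t)) {0..T}"
proof -
  have "(\<lambda>t. norm (q t - r t)) integrable_on {0..T}"
    "(\<lambda>t. norm (velocity T q t - velocity T r t)) integrable_on {0..T}"
    by (intro integrable_continuous_interval continuous_intros twice_differentiable_curve_continuous q r)+
  moreover have "integral {0..T} (\<lambda>t. norm (velocity T (\<lambda>t. q t - r t) t))
      = integral {0..T} (\<lambda>t. norm (velocity T q t - velocity T r t))"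
    by (intro integral_cong) (simp add: velocity_diff[OF assms])
  ultimately show ?thesis
    unfolding W11_norm_def by (simp add: has_integral_add integrable_integral)
qed

lemma W11_norm_diff_nonneg:
  fixes q r :: "real \<Rightarrow> 'a::euclidean_space"
  assumes "T > 0" "twice_differentiable_curve T q" "twice_differentiable_curve T r"
  shows "0 \<le> W11_norm T (\<lambda>t. q t - r t)"
  by (rule has_integral_nonneg[OF W11_norm_diff[OF assms]]) simp

text \<open>The distance on pairs is Euclidean. Bounding it by the sum of the norms gives the
  pointwise form of the integrand of the \<open>W11_norm\<close>.\<close>

lemma lipschitz_on_case_prodD:
  assumes "C-lipschitz_on S (\<lambda>(x, v). f x v)" "(x, v) \<in> S" "(y, w) \<in> S"
  shows "norm (f x v - f y w) \<le> C * (norm (x - y) + norm (v - w))"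
proof -
  have "dist (f x v) (f y w) \<le> C * dist (x, v) (y, w)"
    using lipschitz_onD[OF assms] by simp
  also have "\<dots> \<le> C * (norm (x - y) + norm (v - w))"
    using norm_Pair_le[of "x - y" "v - w"] lipschitz_on_nonneg[OF assms(1)]
    by (intro mult_left_mono) (simp_all add: dist_norm)
  finally show ?thesis by (simp add: dist_norm)
qed

lemma norm_integral_le_W11_norm:
  fixes q r F :: "real \<Rightarrow> 'a::euclidean_space"
  assumes "T > 0" "twice_differentiable_curve T q" "twice_differentiable_curve T r"
    and "F integrable_on {0..T}"
    and "\<And>t. t \<in> {0..T} \<Longrightarrow> norm (F t) \<le> c * (norm (q t - r t) + norm (velocity T q t - velocity T r t))"
  shows "norm (integral {0..T} F) \<le> c * W11_norm T (\<lambda>t. q t - r t)"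
proof -
  have i: "((\<lambda>t. c * (norm (q t - r t) + norm (velocity T q t - velocity T r t))) has_integral
      c * W11_norm T (\<lambda>t. q t - r t)) {0..T}"
    by (intro has_integral_mult_right W11_norm_diff assms)
  show ?thesis
    using integral_norm_bound_integral[OF assms(4) has_integral_integrable[OF i] assms(5)]
    unfolding integral_unique[OF i] .
qed

section \<open>Momentum error on one step\<close>

text \<open>In the constant, 2 counts the two quadrature errors,
  \<open>C\<^sub>\<phi> * (C1 + \<bar>L3\<bar>)\<close> bounds the integral left after integration
  by parts, and \<open>C2\<close> bounds the difference of the initial momenta. The absolute value
  is there because \<open>L3\<close> has no prescribed sign.\<close>

lemma momentum_estimate:
  fixes L :: "'a::euclidean_space \<Rightarrow> 'a \<Rightarrow> real"
  assumes L: "C2_on UNIV (\<lambda>(x, v). L x v)" and G: "galerkin_method G"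
    and \<phi>: "gbasis G 1 0 = 1" "gbasis G 1 (gstep G) = 0"
    and C\<phi>: "Linf_norm (gstep G) (gbasis G 1) \<le> C\<^sub>\<phi>"
    and C1: "C1-lipschitz_on UNIV (\<lambda>(x, v). grad1 L x v)"
    and C2: "C2-lipschitz_on UNIV (\<lambda>(x, v). grad2 L x v)"
    and qg: "twice_differentiable_curve (gstep G) qg"
    and qe: "euler_lagrange L (gstep G) qe"
    and L3: "\<And>t. t \<in> {0..gstep G} \<Longrightarrow>
      norm (velocity (gstep G) (momentum L (gstep G) qg) t - velocity (gstep G) (momentum L (gstep G) qe) t)
        \<le> L3 * norm ((qg t, velocity (gstep G) qg t) - (qe t, velocity (gstep G) qe t))"
    and quad: "norm (quadrature_error G (\<lambda>t. noether_integrand L G qg t - noether_integrand L G qe t))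
        \<le> W11_norm (gstep G) (\<lambda>t. qg t - qe t)"
      "norm (quadrature_error G (noether_integrand L G qe)) \<le> W11_norm (gstep G) (\<lambda>t. qg t - qe t)"
  shows "norm (momentum L (gstep G) qe 0 + quadrature G (noether_integrand L G qg))
    \<le> (2 + C\<^sub>\<phi> * (C1 + \<bar>L3\<bar>) + C2) * (W11_norm (gstep G) (\<lambda>t. qg t - qe t)
       + Linf_norm (gstep G) (\<lambda>t. qg t - qe t)
       + Linf_norm (gstep G) (\<lambda>t. velocity (gstep G) qg t - velocity (gstep G) qe t))"
    (is "_ \<le> _ * (?W + ?Q + ?V)")
proof -
  define h where "h = gstep G"
  define \<phi> where "\<phi> = gbasis G 1"
  define pg where "pg = momentum L h qg"
  define pe where "pe = momentum L h qe"
  have h: "h > 0" and one: "1 \<in> {1..gdim G}"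
    using G unfolding galerkin_method_def h_def by auto
  have qg': "twice_differentiable_curve h qg" using qg by (simp add: h_def)
  have qe': "twice_differentiable_curve h qe"
    using qe C2_on_twice_differentiable_curve[OF h] unfolding euler_lagrange_def h_def by blast
  have \<phi>': "twice_differentiable_curve h \<phi>"
    using galerkin_method_basis[OF G one] by (simp add: h_def \<phi>_def)
  note cont = twice_differentiable_curve_continuous[OF qg'] twice_differentiable_curve_continuous[OF qe']
    twice_differentiable_curve_continuous[OF \<phi>']
  have contL: "continuous_on {0..h} (\<lambda>t. f (x t) (v t))"
    if "C-lipschitz_on UNIV (\<lambda>(x, v). f x v)" "continuous_on {0..h} x" "continuous_on {0..h} v"
    for C x v and f :: "'a \<Rightarrow> 'a \<Rightarrow> 'a"
    using continuous_on_compose2[OF lipschitz_on_continuous_on[OF that(1)] continuous_on_Pair[OF that(2,3)]]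
    by simp
  have F: "noether_integrand L G q t = \<phi> t *\<^sub>R grad1 L (q t) (velocity h q t)
      + velocity h \<phi> t *\<^sub>R momentum L h q t" for q t
    by (simp add: noether_integrand_def momentum_def \<phi>_def h_def)
  have intF: "noether_integrand L G qg integrable_on {0..h}" "noether_integrand L G qe integrable_on {0..h}"
    unfolding F[abs_def] momentum_def[abs_def]
    by (intro integrable_continuous_interval continuous_intros contL[OF C1] contL[OF C2] cont)+
  \<comment> \<open>Since \<open>gbasis G 1\<close> is 1 at time 0 and 0 at time \<open>h\<close>,
    only the left boundary term survives.\<close>
  have parts: "((\<lambda>t. \<phi> t *\<^sub>R p' t + velocity h \<phi> t *\<^sub>R p t) has_integral - p 0) {0..h}"
    if "\<And>t. t \<in> {0..h} \<Longrightarrow> (p has_vector_derivative p' t) (at t within {0..h})"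
    for p p' :: "real \<Rightarrow> 'a"
  proof -
    have "((\<lambda>t. \<phi> t *\<^sub>R p' t + velocity h \<phi> t *\<^sub>R p t) has_integral \<phi> h *\<^sub>R p h - \<phi> 0 *\<^sub>R p 0) {0..h}"
    proof (rule fundamental_theorem_of_calculus)
      show "((\<lambda>t. \<phi> t *\<^sub>R p t) has_vector_derivative \<phi> t *\<^sub>R p' t + velocity h \<phi> t *\<^sub>R p t)
          (at t within {0..h})" if "t \<in> {0..h}" for t
        by (rule has_vector_derivative_scaleR[OF _ \<open>\<And>t. t \<in> {0..h} \<Longrightarrow> (p has_vector_derivative p' t) (at t within {0..h})\<close>[OF that]])
          (use twice_differentiable_curve_velocity[OF \<phi>' that] in \<open>simp add: has_real_derivative_iff_has_vector_derivative\<close>)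
    qed (use h in simp)
    then show ?thesis using assms(3,4) by (simp add: \<phi>_def h_def)
  qed
  have exact: "integral {0..h} (noether_integrand L G qe) = - pe 0"
    unfolding F[abs_def] pe_def
    by (rule integral_unique[OF parts]) (use qe in \<open>auto simp: euler_lagrange_def h_def\<close>)
  define dp where "dp t = velocity h pg t - velocity h pe t" for t
  have dp: "((\<lambda>t. pg t - pe t) has_vector_derivative dp t) (at t within {0..h})" if "t \<in> {0..h}" for t
    unfolding dp_def pg_def pe_def
    by (intro has_vector_derivative_diff momentum_has_vector_derivative[OF L h _ that] qg' qe')
  \<comment> \<open>The difference of the Noether integrands minus the derivative of
    \<open>\<phi> t *\<^sub>R (pg t - pe t)\<close>: every term carrying the velocity of \<phi> has
    cancelled. Along the exact curve the two contributions to \<open>R\<close> cancel by the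
    Euler-Lagrange equation, but the Galerkin curve need not satisfy it.\<close>
  define R where "R t = \<phi> t *\<^sub>R ((grad1 L (qg t) (velocity h qg t) - grad1 L (qe t) (velocity h qe t)) - dp t)" for t
  have "((\<lambda>t. (noether_integrand L G qg t - noether_integrand L G qe t)
      - (\<phi> t *\<^sub>R dp t + velocity h \<phi> t *\<^sub>R (pg t - pe t))) has_integral
      (integral {0..h} (noether_integrand L G qg) - integral {0..h} (noether_integrand L G qe)) - - (pg 0 - pe 0)) {0..h}"
    by (intro has_integral_diff integrable_integral intF parts dp)
  moreover have "(\<lambda>t. (noether_integrand L G qg t - noether_integrand L G qe t)
      - (\<phi> t *\<^sub>R dp t + velocity h \<phi> t *\<^sub>R (pg t - pe t))) = R"
    by (rule ext) (simp add: F R_def pg_def pe_def algebra_simps)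
  ultimately have R: "(R has_integral
      (integral {0..h} (noether_integrand L G qg) - integral {0..h} (noether_integrand L G qe)) + (pg 0 - pe 0)) {0..h}"
    by (simp only: diff_minus_eq_add)
  have C\<phi>0: "\<bar>\<phi> t\<bar> \<le> C\<^sub>\<phi>" if "t \<in> {0..h}" for t
    using norm_le_Linf_norm[OF cont(5) that] C\<phi> by (simp add: \<phi>_def h_def)
  have C0: "0 \<le> C\<^sub>\<phi>" "0 \<le> C1" "0 \<le> C2"
    using C\<phi>0[of 0] h lipschitz_on_nonneg[OF C1] lipschitz_on_nonneg[OF C2] by auto
  have "norm (R t) \<le> (C\<^sub>\<phi> * (C1 + \<bar>L3\<bar>)) * (norm (qg t - qe t) + norm (velocity h qg t - velocity h qe t))"
    if t: "t \<in> {0..h}" for t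
  proof -
    let ?d = "norm (qg t - qe t) + norm (velocity h qg t - velocity h qe t)"
    have "norm (dp t) \<le> L3 * norm ((qg t, velocity h qg t) - (qe t, velocity h qe t))"
      using L3 t by (simp add: dp_def pg_def pe_def h_def)
    also have "\<dots> \<le> \<bar>L3\<bar> * ?d"
      using norm_Pair_le[of "qg t - qe t" "velocity h qg t - velocity h qe t"]
      by (intro mult_mono) auto
    finally have "norm ((grad1 L (qg t) (velocity h qg t) - grad1 L (qe t) (velocity h qe t)) - dp t)
        \<le> C1 * ?d + \<bar>L3\<bar> * ?d"
      using lipschitz_on_case_prodD[OF C1, of "qg t" "velocity h qg t" "qe t" "velocity h qe t"]
      by (intro norm_triangle_le_diff) simp
    then have "norm (R t) \<le> C\<^sub>\<phi> * (C1 * ?d + \<bar>L3\<bar> * ?d)"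
      unfolding R_def norm_scaleR using C\<phi>0[OF t] C0 by (intro mult_mono) auto
    then show ?thesis by (simp add: algebra_simps)
  qed
  then have Rle: "norm (integral {0..h} R) \<le> C\<^sub>\<phi> * (C1 + \<bar>L3\<bar>) * ?W"
    using norm_integral_le_W11_norm[OF h qg' qe' has_integral_integrable[OF R]] by (simp add: h_def)
  have QV: "norm (qg 0 - qe 0) \<le> ?Q" "norm (velocity h qg 0 - velocity h qe 0) \<le> ?V"
    using h norm_le_Linf_norm[of h "\<lambda>t. qg t - qe t" 0]
      norm_le_Linf_norm[of h "\<lambda>t. velocity h qg t - velocity h qe t" 0]
    by (auto simp: h_def[symmetric] intro!: continuous_intros cont)
  have "norm (pg 0 - pe 0) \<le> C2 * (norm (qg 0 - qe 0) + norm (velocity h qg 0 - velocity h qe 0))"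
    unfolding pg_def pe_def momentum_def by (rule lipschitz_on_case_prodD[OF C2]) auto
  also have "\<dots> \<le> C2 * (?Q + ?V)"
    using QV C0 by (intro mult_left_mono) auto
  finally have ple: "norm (pg 0 - pe 0) \<le> C2 * (?Q + ?V)" .
  \<comment> \<open>The quadrature is written as the error on the difference, the error on the exact
    curve and the integral along the Galerkin curve; \<open>exact\<close> and \<open>R\<close>
    evaluate the last one.\<close>
  have split: "pe 0 + quadrature G (noether_integrand L G qg)
      = quadrature_error G (\<lambda>t. noether_integrand L G qg t - noether_integrand L G qe t)
        + quadrature_error G (noether_integrand L G qe) + integral {0..h} R - (pg 0 - pe 0)"
    using integral_unique[OF R] exact integral_diff[OF intF]
    by (simp add: quadrature_error_def quadrature_diff h_def[symmetric])
  have "norm (pe 0 + quadrature G (noether_integrand L G qg)) \<le> ?W + ?W + C\<^sub>\<phi> * (C1 + \<bar>L3\<bar>) * ?W + C2 * (?Q + ?V)"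
    unfolding split
    by (rule order_trans[OF norm_triangle_ineq4 add_mono[OF _ ple]],
        rule order_trans[OF norm_triangle_ineq add_mono[OF _ Rle]],
        rule order_trans[OF norm_triangle_ineq add_mono[OF quad]])
  also have "\<dots> \<le> (2 + C\<^sub>\<phi> * (C1 + \<bar>L3\<bar>) + C2) * (?W + ?Q + ?V)"
  proof -
    have expand: "w + w + c * w + d * (q + v) \<le> (2 + c + d) * (w + q + v)"
      if "0 \<le> w" "0 \<le> q" "0 \<le> v" "0 \<le> c" "0 \<le> d" for w q v c d :: real
    proof -
      have "(2 + c + d) * (w + q + v) = (w + w + c * w + d * (q + v)) + (2 * (q + v) + c * (q + v) + d * w)"
        by algebra
      moreover have "0 \<le> 2 * (q + v) + c * (q + v) + d * w"
        using that by simp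
      ultimately show ?thesis by linarith
    qed
    show ?thesis
    proof (rule expand)
      show "0 \<le> ?W" using W11_norm_diff_nonneg[OF h qg' qe'] by (simp add: h_def)
      show "0 \<le> ?Q" by (rule order_trans[OF norm_ge_zero QV(1)])
      show "0 \<le> ?V" by (rule order_trans[OF norm_ge_zero QV(2)])
    qed (use C0 in auto)
  qed
  finally show ?thesis by (simp add: pe_def h_def)
qed

section \<open>Drift of the Noether quantity over all steps\<close>

text \<open>Within a step, invariance trades the left partial gradient for the right one; the
  discrete Euler-Lagrange equation hands the latter over to the next step.\<close>

lemma discrete_noether_quantity_conserved:
  fixes L :: "'a::euclidean_space \<Rightarrow> 'a \<Rightarrow> real"
  assumes g: "one_parameter_group g" and inv: "invariant_Ld g L G"
    and traj: "galerkin_trajectory L G N q qg qe qx" and k: "k \<in> {1..N}"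
  shows "grad1 (Ld L G) (q k) (q (k + 1)) \<bullet> generator g (q k)
    = grad1 (Ld L G) (q 1) (q 2) \<bullet> generator g (q 1)"
proof -
  have "1 \<le> k" using k by simp
  then have "k \<le> N \<longrightarrow> ?thesis"
  proof (induction k rule: dec_induct)
    case base
    show ?case by (simp add: numeral_2_eq_2)
  next
    case (step k)
    show ?case
    proof
      assume "Suc k \<le> N"
      have "(q k, q (k + 1)) \<in> interior (Ld_domain L G)"
        "(\<lambda>(x, y). Ld L G x y) differentiable (at (q k, q (k + 1)))"
        using traj step \<open>Suc k \<le> N\<close> unfolding galerkin_trajectory_def by auto
      from discrete_noether[OF g inv this]
      have "generator g (q k) \<bullet> grad1 (Ld L G) (q k) (q (k + 1))
          + generator g (q (k + 1)) \<bullet> grad2 (Ld L G) (q k) (q (k + 1)) = 0" .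
      \<comment> \<open>The equation with index \<open>Suc k\<close> couples steps \<open>k\<close>
        and \<open>Suc k\<close>; \<open>Suc k \<le> N\<close> keeps it in range.\<close>
      moreover have "\<forall>k\<in>{2..N}. grad2 (Ld L G) (q (k - 1)) (q k) + grad1 (Ld L G) (q k) (q (k + 1)) = 0"
        using traj unfolding galerkin_trajectory_def by blast
      then have "grad2 (Ld L G) (q k) (q (Suc k)) + grad1 (Ld L G) (q (Suc k)) (q (Suc k + 1)) = 0"
        using step \<open>Suc k \<le> N\<close> by (auto dest!: bspec[of _ _ "Suc k"])
      then have "grad2 (Ld L G) (q k) (q (k + 1)) = - grad1 (Ld L G) (q (Suc k)) (q (Suc k + 1))"
        by (simp add: add_eq_0_iff)
      ultimately show "grad1 (Ld L G) (q (Suc k)) (q (Suc k + 1)) \<bullet> generator g (q (Suc k))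
          = grad1 (Ld L G) (q 1) (q 2) \<bullet> generator g (q 1)"
        using step \<open>Suc k \<le> N\<close> by (simp add: inner_commute)
    qed
  qed
  then show ?thesis using k by simp
qed

text \<open>The global solution and the first local one have velocities taken within different
  intervals. At 0 both are the same right-hand derivative.\<close>

lemma momentum_0_eq_on_subinterval:
  fixes q r :: "real \<Rightarrow> 'a::euclidean_space"
  assumes h: "0 < h" "h \<le> T" and q: "twice_differentiable_curve T q"
    and eq: "\<And>t. t \<in> {0..h} \<Longrightarrow> q t = r t"
  shows "momentum L T q 0 = momentum L h r 0"
proof -
  have "(q has_vector_derivative velocity T q 0) (at 0 within {0..h})"
    by (rule has_vector_derivative_within_subset[OF twice_differentiable_curve_velocity[OF q]])
      (use h in auto)
  then have "(r has_vector_derivative velocity T q 0) (at 0 within {0..h})"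
    by (rule has_vector_derivative_transform[rotated 2]) (use h eq in auto)
  then have "velocity h r 0 = velocity T q 0"
    using velocity_eq[OF h(1)] h by force
  then show ?thesis
    using eq[of 0] h by (simp add: momentum_def)
qed

text \<open>The momentum estimate enters twice, for steps 1 and \<open>k\<close>, each time
  multiplied by the bound \<open>C\<^sub>a\<close> on the generator at the node. The summand
  \<open>C\<^sub>I * (C2 + 1)\<close> compares the exact and the Galerkin curve at time
  \<open>t\<close>: \<open>C2\<close> for the momenta, 1 for the positions. The set \<open>P\<close>
  is where the Noether map is Lipschitz, so both curves have to stay in it.\<close>

lemma noether_drift:
  fixes L :: "'a::euclidean_space \<Rightarrow> 'a \<Rightarrow> real"
  assumes L: "C2_on UNIV (\<lambda>(x, v). L x v)" and G: "galerkin_method G"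
    and g: "one_parameter_group g" and L_inv: "invariant_lagrangian g L" and Ld_inv: "invariant_Ld g L G"
    and \<phi>: "gbasis G 1 0 = 1" "gbasis G 1 (gstep G) = 0"
    and C\<phi>: "Linf_norm (gstep G) (gbasis G 1) \<le> C\<^sub>\<phi>"
    and C1: "C1-lipschitz_on UNIV (\<lambda>(x, v). grad1 L x v)"
    and C2: "C2-lipschitz_on UNIV (\<lambda>(x, v). grad2 L x v)"
    and CI: "C\<^sub>I-lipschitz_on P (\<lambda>(p, q). noether_map g p q)"
    and h: "gstep G = h"
    and traj: "galerkin_trajectory L G N q qg qe qx"
    and L3: "\<And>k t. k \<in> {1..N} \<Longrightarrow> t \<in> {0..h} \<Longrightarrow>
      norm (velocity h (momentum L h (qg k)) t - velocity h (momentum L h (qe k)) t)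
        \<le> L3 * norm ((qg k t, velocity h (qg k) t) - (qe k t, velocity h (qe k) t))"
    and quad: "\<And>k. k \<in> {1..N} \<Longrightarrow>
        norm (quadrature_error G (\<lambda>t. noether_integrand L G (qg k) t - noether_integrand L G (qe k) t))
          \<le> W11_norm h (\<lambda>t. qg k t - qe k t)"
      "\<And>k. k \<in> {1..N} \<Longrightarrow>
        norm (quadrature_error G (noether_integrand L G (qe k))) \<le> W11_norm h (\<lambda>t. qg k t - qe k t)"
    and Ca: "\<And>k. k \<in> {1..N} \<Longrightarrow> norm (generator g (q k)) \<le> C\<^sub>a"
    and P: "\<And>k t. k \<in> {1..N} \<Longrightarrow> t \<in> {0..h} \<Longrightarrow> (momentum L h (qg k) t, qg k t) \<in> P"
      "\<And>k t. k \<in> {1..N} \<Longrightarrow> t \<in> {0..h} \<Longrightarrow> (momentum L h (qe k) t, qe k t) \<in> P"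
    and k: "k \<in> {1..N}" and t: "t \<in> {0..h}"
    and M: "\<And>j. j \<in> {1..N} \<Longrightarrow> W11_norm h (\<lambda>t. qg j t - qe j t) + Linf_norm h (\<lambda>t. qg j t - qe j t)
        + Linf_norm h (\<lambda>t. velocity h (qg j) t - velocity h (qe j) t) \<le> M"
  shows "\<bar>noether_map g (momentum L (real N * h) qx 0) (qx 0) - noether_map g (momentum L h (qg k) t) (qg k t)\<bar>
    \<le> (2 * C\<^sub>a * (2 + C\<^sub>\<phi> * (C1 + \<bar>L3\<bar>) + C2) + C\<^sub>I * (C2 + 1)) * M"
proof -
  define K where "K = 2 + C\<^sub>\<phi> * (C1 + \<bar>L3\<bar>) + C2"
  define D where "D j = grad1 (Ld L G) (q j) (q (j + 1))" for j
  have h0: "h > 0" and one: "1 \<in> {1..gdim G}"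
    using G h unfolding galerkin_method_def by auto
  have 1: "1 \<in> {1..N}" using k by simp
  have step: "(q j, q (j + 1)) \<in> interior (Ld_domain L G)"
      "(\<lambda>(x, y). Ld L G x y) differentiable (at (q j, q (j + 1)))"
      "discrete_minimizer L G (q j) (q (j + 1)) (qg j)"
      "euler_lagrange L h (qe j)" "qe j 0 = q j"
      if "j \<in> {1..N}" for j
    using traj that h unfolding galerkin_trajectory_def local_exact_solution_def by auto
  have qg: "twice_differentiable_curve h (qg j)" if "j \<in> {1..N}" for j
    using step(3)[OF that] twice_differentiable_galerkin_curve[OF G] h
    unfolding discrete_minimizer_def galerkin_space_def by auto
  have qe: "twice_differentiable_curve h (qe j)" if "j \<in> {1..N}" for j
    using step(4)[OF that] C2_on_twice_differentiable_curve[OF h0] unfolding euler_lagrange_def by blast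
  note cont = twice_differentiable_curve_continuous[OF qg[OF k]] twice_differentiable_curve_continuous[OF qe[OF k]]
  have phi_cont: "continuous_on {0..h} (gbasis G 1)"
    using twice_differentiable_curve_continuous[OF galerkin_method_basis[OF G one]] h by simp
  have C0: "0 \<le> C\<^sub>\<phi>" "0 \<le> C1" "0 \<le> C2" "0 \<le> C\<^sub>I" "0 \<le> C\<^sub>a"
    using norm_le_Linf_norm[OF phi_cont, of 0] C\<phi> \<phi>(1) h h0
      lipschitz_on_nonneg[OF C1] lipschitz_on_nonneg[OF C2] lipschitz_on_nonneg[OF CI]
      order_trans[OF norm_ge_zero Ca[OF k]] by auto
  then have K0: "0 \<le> K" by (simp add: K_def)
  have "norm (momentum L h (qe j) 0 + D j) \<le> K * M" if j: "j \<in> {1..N}" for j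
  proof -
    have "D j = quadrature G (noether_integrand L G (qg j))"
      unfolding D_def by (rule grad1_Ld[OF L G \<phi> step(1-3)[OF j]])
    then have "norm (momentum L h (qe j) 0 + D j) \<le> K * (W11_norm h (\<lambda>t. qg j t - qe j t)
        + Linf_norm h (\<lambda>t. qg j t - qe j t) + Linf_norm h (\<lambda>t. velocity h (qg j) t - velocity h (qe j) t))"
      using momentum_estimate[OF L G \<phi> C\<phi> C1 C2, unfolded h, OF qg[OF j] step(4)[OF j] L3[OF j] quad(1)[OF j] quad(2)[OF j]]
      by (simp add: K_def)
    also have "\<dots> \<le> K * M" by (rule mult_left_mono[OF M[OF j] K0])
    finally show ?thesis .
  qed
  \<comment> \<open>The discrete momentum is \<open>- D j\<close>, so this sum is the difference
    between the exact and the discrete Noether quantity at the start of step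
    \<open>j\<close>.\<close>
  then have drift: "\<bar>noether_map g (momentum L h (qe j) 0) (q j) + D j \<bullet> generator g (q j)\<bar> \<le> K * M * C\<^sub>a"
    if j: "j \<in> {1..N}" for j
  proof -
    have "\<bar>(momentum L h (qe j) 0 + D j) \<bullet> generator g (q j)\<bar>
        \<le> norm (momentum L h (qe j) 0 + D j) * norm (generator g (q j))"
      by (rule Cauchy_Schwarz_ineq2)
    also have "\<dots> \<le> K * M * C\<^sub>a"
      using \<open>\<And>j. j \<in> {1..N} \<Longrightarrow> norm (momentum L h (qe j) 0 + D j) \<le> K * M\<close>[OF j] Ca[OF j]
      by (intro mult_mono) (auto intro: order_trans[OF norm_ge_zero])
    finally show ?thesis by (simp add: noether_map_def inner_add_left)
  qed
  have conserved: "D k \<bullet> generator g (q k) = D 1 \<bullet> generator g (q 1)"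
    using discrete_noether_quantity_conserved[OF g Ld_inv traj k] by (simp add: D_def numeral_2_eq_2)
  have exact: "noether_map g (momentum L h (qe k) t) (qe k t) = noether_map g (momentum L h (qe k) 0) (q k)"
    using noether_map_conserved[OF L g L_inv h0 step(4)[OF k] t] step(5)[OF k] by simp
  have start: "noether_map g (momentum L (real N * h) qx 0) (qx 0) = noether_map g (momentum L h (qe 1) 0) (q 1)"
  proof -
    have N: "h \<le> real N * h" using 1 h0 by simp
    have "C2_on {0..real N * h} qx" and eq: "\<And>t. t \<in> {0..h} \<Longrightarrow> qx t = qe 1 t"
      using traj h unfolding galerkin_trajectory_def euler_lagrange_def by auto
    then have "momentum L (real N * h) qx 0 = momentum L h (qe 1) 0"
      using N h0 by (intro momentum_0_eq_on_subinterval C2_on_twice_differentiable_curve) auto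
    then show ?thesis using eq[of 0] h0 step(5)[OF 1] by simp
  qed
  have "\<bar>noether_map g (momentum L h (qe k) t) (qe k t) - noether_map g (momentum L h (qg k) t) (qg k t)\<bar>
      \<le> C\<^sub>I * (C2 + 1) * M"
  proof -
    let ?q = "norm (qe k t - qg k t)" and ?v = "norm (velocity h (qe k) t - velocity h (qg k) t)"
    have "\<bar>noether_map g (momentum L h (qe k) t) (qe k t) - noether_map g (momentum L h (qg k) t) (qg k t)\<bar>
        \<le> C\<^sub>I * (norm (momentum L h (qe k) t - momentum L h (qg k) t) + ?q)"
      using lipschitz_on_case_prodD[OF CI P(2)[OF k t] P(1)[OF k t]] by simp
    also have "\<dots> \<le> C\<^sub>I * (C2 * (?q + ?v) + 1 * (?q + ?v))"
      using lipschitz_on_case_prodD[OF C2, of "qe k t" "velocity h (qe k) t" "qg k t" "velocity h (qg k) t"] C0(4)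
      by (intro mult_left_mono add_mono) (auto simp: momentum_def)
    also have "\<dots> = C\<^sub>I * (C2 + 1) * (?q + ?v)" by (simp add: algebra_simps)
    also have "?q + ?v \<le> M"
    proof -
      have "?q \<le> Linf_norm h (\<lambda>t. qg k t - qe k t)"
        "?v \<le> Linf_norm h (\<lambda>t. velocity h (qg k) t - velocity h (qe k) t)"
        using norm_le_Linf_norm[of h "\<lambda>t. qg k t - qe k t" t] t
          norm_le_Linf_norm[of h "\<lambda>t. velocity h (qg k) t - velocity h (qe k) t" t]
        by (simp_all add: norm_minus_commute continuous_on_diff cont)
      moreover have "0 \<le> W11_norm h (\<lambda>t. qg k t - qe k t)"
        by (rule W11_norm_diff_nonneg[OF h0 qg[OF k] qe[OF k]])
      ultimately show ?thesis using M[OF k] by linarith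
    qed
    finally show ?thesis using C0 by (simp add: mult_left_mono)
  qed
  \<comment> \<open>The discrete quantities of steps 1 and \<open>k\<close> cancel, which leaves
    three errors whatever the number of steps.\<close>
  then have "\<bar>noether_map g (momentum L (real N * h) qx 0) (qx 0) - noether_map g (momentum L h (qg k) t) (qg k t)\<bar>
      \<le> K * M * C\<^sub>a + K * M * C\<^sub>a + C\<^sub>I * (C2 + 1) * M"
    using drift[OF 1] drift[OF k] conserved unfolding exact start by linarith
  also have "\<dots> = (2 * C\<^sub>a * K + C\<^sub>I * (C2 + 1)) * M" by (simp add: algebra_simps)
  finally show ?thesis unfolding K_def .
qed

theorem theorem3p11:
  fixes L :: "real ^ 'd \<Rightarrow> real ^ 'd \<Rightarrow> real"
    and g :: "real \<Rightarrow> real ^ 'd \<Rightarrow> real ^ 'd"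
    and \<G> :: "galerkin set"
    and P :: "((real ^ 'd) \<times> (real ^ 'd)) set"
    and L3 C\<^sub>a :: real
  assumes smooth: "C2_on UNIV (\<lambda>(x, v). L x v)"
    and methods: "\<forall>G\<in>\<G>. galerkin_method G"
    and family: "inj_on (\<lambda>G. (gdim G, gstep G)) \<G>"
    and group: "one_parameter_group g"
    and L_inv: "invariant_lagrangian g L"
    and Ld_inv: "\<forall>G\<in>\<G>. invariant_Ld g L G"
    and i: "(\<exists>h. \<forall>G\<in>\<G>. gstep G = h) \<and>
              (\<exists>C\<^sub>g K\<^sub>g. K\<^sub>g < 1 \<and> (\<forall>G\<in>\<G>. \<forall>r\<in>galerkin_space G.
                 \<bar>action L (gstep G) r - discrete_action L G r\<bar> \<le> C\<^sub>g * K\<^sub>g ^ gdim G))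
            \<or> (\<exists>n. \<forall>G\<in>\<G>. gdim G = n) \<and>
              (\<exists>C\<^sub>g. \<forall>G\<in>\<G>. \<forall>r\<in>galerkin_space G.
                 \<bar>action L (gstep G) r - discrete_action L G r\<bar> \<le> C\<^sub>g * gstep G ^ (gdim G + 1))"
    and ii: "\<exists>C. C-lipschitz_on UNIV (\<lambda>(x, v). grad1 L x v)"
            "\<exists>C. C-lipschitz_on UNIV (\<lambda>(x, v). grad2 L x v)"
    and iii: "\<forall>h. \<exists>C. \<forall>G\<in>\<G>. gstep G = h \<longrightarrow> Linf_norm h (gbasis G 1) \<le> C"
    and v: "\<forall>G\<in>\<G>. gbasis G 1 0 = 1 \<and> gbasis G 1 (gstep G) = 0"
    and vii: "\<exists>C. C-lipschitz_on P (\<lambda>(p, q). noether_map g p q)"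
  shows "\<forall>h. \<exists>C\<^sub>v. \<forall>G\<in>\<G>. gstep G = h \<longrightarrow>
    (\<forall>N q qg qe qx.
       N \<ge> 1 \<and>
       galerkin_trajectory L G N q qg qe qx \<and>
       (\<forall>k\<in>{1..N}. \<forall>t\<in>{0..h}.
          norm (velocity h (momentum L h (qg k)) t - velocity h (momentum L h (qe k)) t)
            \<le> L3 * norm ((qg k t, velocity h (qg k) t) - (qe k t, velocity h (qe k) t))) \<and>
       (\<forall>k\<in>{1..N}.
          norm (quadrature_error G
                  (\<lambda>t. noether_integrand L G (qg k) t - noether_integrand L G (qe k) t))
            \<le> W11_norm h (\<lambda>t. qg k t - qe k t) \<and>
          norm (quadrature_error G (noether_integrand L G (qe k)))
            \<le> W11_norm h (\<lambda>t. qg k t - qe k t)) \<and>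
       (\<forall>k\<in>{1..N}. norm (generator g (q k)) \<le> C\<^sub>a) \<and>
       (\<forall>k\<in>{1..N}. \<forall>t\<in>{0..h}.
          (momentum L h (qg k) t, qg k t) \<in> P \<and> (momentum L h (qe k) t, qe k t) \<in> P)
       \<longrightarrow> (\<forall>t\<in>{0..real N * h}. \<forall>k\<in>{1..N}. (real k - 1) * h \<le> t \<and> t \<le> real k * h \<longrightarrow>
             \<bar>noether_map g (momentum L (real N * h) qx 0) (qx 0)
               - noether_map g (momentum L h (qg k) (t - (real k - 1) * h))
                               (qg k (t - (real k - 1) * h))\<bar>
             \<le> C\<^sub>v * (MAX j\<in>{1..N}.
                   W11_norm h (\<lambda>t. qg j t - qe j t)
                   + Linf_norm h (\<lambda>t. qg j t - qe j t)
                   + Linf_norm h (\<lambda>t. velocity h (qg j) t - velocity h (qe j) t))))"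
proof (rule allI, goal_cases)
  case (1 h)
  obtain C1 where C1: "C1-lipschitz_on UNIV (\<lambda>(x, v). grad1 L x v)" using ii(1) by blast
  obtain C2 where C2: "C2-lipschitz_on UNIV (\<lambda>(x, v). grad2 L x v)" using ii(2) by blast
  obtain C\<^sub>I where C\<^sub>I: "C\<^sub>I-lipschitz_on P (\<lambda>(p, q). noether_map g p q)" using vii by blast
  obtain C\<^sub>\<phi> where C\<^sub>\<phi>: "\<forall>G\<in>\<G>. gstep G = h \<longrightarrow> Linf_norm h (gbasis G 1) \<le> C\<^sub>\<phi>"
    using iii by meson
  \<comment> \<open>Of the constants below, \<open>C\<^sub>\<phi>\<close> alone was chosen after
    \<open>h\<close>, and none depends on the method \<open>G\<close>, on \<open>N\<close> or on the
    trajectory.\<close>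
  show ?case
  proof (rule exI[of _ "2 * C\<^sub>a * (2 + C\<^sub>\<phi> * (C1 + \<bar>L3\<bar>) + C2) + C\<^sub>I * (C2 + 1)"],
      intro ballI impI allI, elim conjE, goal_cases)
    case prems: (1 G N q qg qe qx t k)
    have G: "galerkin_method G" "invariant_Ld g L G" "gbasis G 1 0 = 1" "gbasis G 1 (gstep G) = 0"
      "Linf_norm (gstep G) (gbasis G 1) \<le> C\<^sub>\<phi>"
      using methods Ld_inv v C\<^sub>\<phi> prems(1,2) by auto
    show ?case
    proof (rule noether_drift[OF smooth G(1) group L_inv G(2-5) C1 C2 C\<^sub>I prems(2)])
      show "galerkin_trajectory L G N q qg qe qx" "k \<in> {1..N}" by fact+
      \<comment> \<open>This is the local time on step \<open>k\<close>. A node shared by two steps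
        belongs to both, as the end of one and the start of the other.\<close>
      show "t - (real k - 1) * h \<in> {0..h}"
        using prems by (simp add: algebra_simps)
      show "W11_norm h (\<lambda>t. qg j t - qe j t) + Linf_norm h (\<lambda>t. qg j t - qe j t)
          + Linf_norm h (\<lambda>t. velocity h (qg j) t - velocity h (qe j) t)
        \<le> (MAX j\<in>{1..N}. W11_norm h (\<lambda>t. qg j t - qe j t) + Linf_norm h (\<lambda>t. qg j t - qe j t)
          + Linf_norm h (\<lambda>t. velocity h (qg j) t - velocity h (qe j) t))" if "j \<in> {1..N}" for j
        by (rule Max_ge) (use that in auto)
    qed (use prems in blast)+
  qed
qed

end
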